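(* Suppose that the decoder moments satisfy $\mu_x = W z + b$ and $\Sigma_x = \lambda I$ for parameters $\theta = \{W, b, \lambda\}$ with $W \in \mathbb{R}^{d\times\kappa}$, $b \in \mathbb{R}^d$, $\lambda > 0$. Suppose furthermore that the encoder moments are $\mu_z = f(x;\phi)$ and $\Sigma_z = S_z S_z^{\top}$ with $S_z = g(x;\phi)$, where $f$ and $g$ are any parameterized functional forms that include arbitrary affine transformations (of $x$) for some arrangement of the parameters $\phi$. Then the VAE objective $\mathcal{L}(\theta,\phi)$ admits optimal, closed-form solutions for $\mu_z$ and $\Sigma_z$ in terms of $W$, $b$ and $\lambda$ such that the resulting VAE cost (the objective minimized over the encoder, up to an overall factor of $2$ and an additive constant independent of $W,b,\lambda$) collapses to $$\mathcal{L}(W,b,\lambda) = \sum_{i=1}^n \Omega^{(i)}(W,b,\lambda I) + n \log\left|\lambda I + W W^{\top}\right|,$$ where $$\Omega^{(i)}(W,b,\Psi) = \left(x^{(i)} - b\right)^{\top}\left(\Psi + W W^{\top}\right)^{-1}\left(x^{(i)} - b\right).$$ Additionally, if one enforces that the off-diagonal elements of $\Sigma_z$ must be equal to zero (i.e., $[\Sigma_z]_{ij} = 0$ for $i \neq j$), then in the same sense the resulting cost becomes $$\mathcal{L}_{sep}(W,b,\lambda) = \sum_{i=1}^n \Omega^{(i)}(W,b,\lambda I) + n\left[\sum_{j=1}^{\kappa} \log\left(\lambda + \|w_{\cdot j}\|_2^2\right) + (d-\kappa)\log\lambda\right],$$ where $w_{\cdot j}$ is the $j$-th column of $W$.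
   Context: Data: samples $x^{(1)},\dots,x^{(n)} \in \mathbb{R}^d$; latent variable $z \in \mathbb{R}^{\kappa}$. The variational autoencoder (VAE) objective is $$\mathcal{L}(\theta,\phi) = \sum_{i=1}^n \left( \mathrm{KL}\left[q_\phi(z|x^{(i)}) \,\|\, p(z)\right] - \mathbb{E}_{q_\phi(z|x^{(i)})}\left[\log p_\theta(x^{(i)}|z)\right]\right),$$ with prior $p(z) = \mathcal{N}(z;0,I)$, encoder $q_\phi(z|x) = \mathcal{N}(z;\mu_z,\Sigma_z)$ where $\mu_z = \mu_z(x;\phi)$, $\Sigma_z = \Sigma_z(x;\phi)$, and decoder $p_\theta(x|z) = \mathcal{N}(x;\mu_x,\Sigma_x)$ where $\mu_x = \mu_x(z;\theta)$, $\Sigma_x = \Sigma_x(z;\theta)$. The paper's convention is that irrelevant additive constants (and the common factor $\tfrac12$) are dropped, e.g. $2\,\mathrm{KL}[q_\phi(z|x)\|p(z)] \equiv \mathrm{tr}[\Sigma_z] + \|\mu_z\|_2^2 - \log|\Sigma_z|$. The assumption that $f,g$ include arbitrary affine transformations means that for any affine map $A:\mathbb{R}^d\to\mathbb{R}^\kappa$ and any affine map $B:\mathbb{R}^d\to\mathbb{R}^{\kappa\times\kappa}$ (in the second part of the lemma, any diagonal-valued $B$) there is a $\phi$ with $f(\cdot;\phi)=A$ and $g(\cdot;\phi)=B$. $|\cdot|$ of a matrix denotes its determinant. *)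

theory Defs
  imports "HOL-Probability.Probability"
begin

definition mvn_density :: "real^'m \<Rightarrow> real^'m^'m \<Rightarrow> real^'m \<Rightarrow> real" where
  "mvn_density \<mu> \<Sigma> y =
     exp (- ((y - \<mu>) \<bullet> (matrix_inv \<Sigma> *v (y - \<mu>))) / 2) / sqrt ((2 * pi) ^ CARD('m) * det \<Sigma>)"

(* N(\<mu>, \<Sigma>) as a measure, for positive semidefinite \<Sigma>.  A singular \<Sigma>
   (which an encoder covariance S S^T may be) has no density; N(\<mu>, \<Sigma>) is then the law of
   \<mu> + A u with u standard normal and A A^T = \<Sigma>, which does not depend on the choice of A. *)
definition mvn :: "real^'m \<Rightarrow> real^'m^'m \<Rightarrow> (real^'m) measure" where
  "mvn \<mu> \<Sigma> =
     (if invertible \<Sigma> then density lborel (\<lambda>y. ennreal (mvn_density \<mu> \<Sigma> y))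
      else distr (density lborel (\<lambda>u. ennreal (mvn_density 0 (mat 1) u))) borel
             (\<lambda>u. \<mu> + (SOME A :: real^'m^'m. A ** transpose A = \<Sigma>) *v u))"

(* KL[q || p] in nats, extended-real valued.  KL_divergence takes the reference measure p first, and is a
   Bochner integral, hence 0 when the integral diverges.  For q absolutely continuous with respect
   to p the negative part of the integrand is always integrable, so divergence means \<infinity>. *)
definition KL :: "'a measure \<Rightarrow> 'a measure \<Rightarrow> ereal" where
  "KL q p =
     (if absolutely_continuous p q \<and> integrable q (entropy_density (exp 1) p q)
      then ereal (KL_divergence (exp 1) p q) else \<infinity>)"

(* Samples x 0, ..., x (n - 1); decoder moments \<mu>x, \<Sigma>x as functions of z; encoder moments \<mu>z, \<Sigma>z as
   functions of x. *)
definition vae_objective ::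
  "nat \<Rightarrow> (nat \<Rightarrow> real^'d) \<Rightarrow> (real^'k \<Rightarrow> real^'d) \<Rightarrow> (real^'k \<Rightarrow> real^'d^'d) \<Rightarrow>
   (real^'d \<Rightarrow> real^'k) \<Rightarrow> (real^'d \<Rightarrow> real^'k^'k) \<Rightarrow> ereal" where
  "vae_objective n x \<mu>x \<Sigma>x \<mu>z \<Sigma>z =
     (\<Sum>i<n. KL (mvn (\<mu>z (x i)) (\<Sigma>z (x i))) (mvn 0 (mat 1))
        - ereal (\<integral>z. ln (mvn_density (\<mu>x z) (\<Sigma>x z) (x i)) \<partial>mvn (\<mu>z (x i)) (\<Sigma>z (x i))))"

definition affine_map :: "('a::real_vector \<Rightarrow> 'b::real_vector) \<Rightarrow> bool" where
  "affine_map h \<longleftrightarrow> (\<exists>L c. linear L \<and> h = (\<lambda>x. L x + c))"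

definition diagonal :: "real^'m^'m \<Rightarrow> bool" where
  "diagonal M \<longleftrightarrow> (\<forall>i j. i \<noteq> j \<longrightarrow> M $ i $ j = 0)"

definition includes_affine ::
  "(real^'d \<Rightarrow> 'p \<Rightarrow> real^'k) \<Rightarrow> (real^'d \<Rightarrow> 'p \<Rightarrow> real^'k^'k) \<Rightarrow> bool" where
  "includes_affine f g \<longleftrightarrow>
     (\<forall>A B. affine_map A \<and> affine_map B \<longrightarrow> (\<exists>\<phi>. \<forall>x. f x \<phi> = A x \<and> g x \<phi> = B x))"

definition includes_diagonal_affine ::
  "(real^'d \<Rightarrow> 'p \<Rightarrow> real^'k) \<Rightarrow> (real^'d \<Rightarrow> 'p \<Rightarrow> real^'k^'k) \<Rightarrow> bool" where
  "includes_diagonal_affine f g \<longleftrightarrow>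
     (\<forall>A B. affine_map A \<and> affine_map B \<and> (\<forall>x. diagonal (B x)) \<longrightarrow>
        (\<exists>\<phi>. \<forall>x. f x \<phi> = A x \<and> g x \<phi> = B x))"

lemma includes_affine_imp_diagonal: "includes_affine f g \<Longrightarrow> includes_diagonal_affine f g"
  unfolding includes_affine_def includes_diagonal_affine_def by blast

definition encoder_cov ::
  "(real^'d \<Rightarrow> 'p \<Rightarrow> real^'k^'k) \<Rightarrow> 'p \<Rightarrow> real^'d \<Rightarrow> real^'k^'k" where
  "encoder_cov g \<phi> x = g x \<phi> ** transpose (g x \<phi>)"

(* The objective for the affine decoder; mat l is the scalar matrix l I. *)
definition affine_vae ::
  "nat \<Rightarrow> (nat \<Rightarrow> real^'d) \<Rightarrow> (real^'d \<Rightarrow> 'p \<Rightarrow> real^'k) \<Rightarrow> (real^'d \<Rightarrow> 'p \<Rightarrow> real^'k^'k) \<Rightarrow>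
   real^'k^'d \<Rightarrow> real^'d \<Rightarrow> real \<Rightarrow> 'p \<Rightarrow> ereal" where
  "affine_vae n x f g W b l \<phi> =
     vae_objective n x (\<lambda>z. W *v z + b) (\<lambda>z. mat l) (\<lambda>y. f y \<phi>) (encoder_cov g \<phi>)"

(* The closed-form optimal encoder moments; the optimal mean is the same for full and for diagonal
   encoder covariance. *)
definition opt_mean :: "real^'k^'d \<Rightarrow> real^'d \<Rightarrow> real \<Rightarrow> real^'d \<Rightarrow> real^'k" where
  "opt_mean W b l y = transpose W *v (matrix_inv (mat l + W ** transpose W) *v (y - b))"

definition opt_cov :: "real^'k^'d \<Rightarrow> real \<Rightarrow> real^'k^'k" where
  "opt_cov W l = matrix_inv (mat 1 + (1 / l) *\<^sub>R (transpose W ** W))"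

definition opt_cov_sep :: "real^'k^'d \<Rightarrow> real \<Rightarrow> real^'k^'k" where
  "opt_cov_sep W l = (\<chi> i j. if i = j then l / (l + (norm (column j W))\<^sup>2) else 0)"

definition Omega :: "real^'d \<Rightarrow> real^'k^'d \<Rightarrow> real^'d \<Rightarrow> real^'d^'d \<Rightarrow> real" where
  "Omega y W b \<Psi> = (y - b) \<bullet> (matrix_inv (\<Psi> + W ** transpose W) *v (y - b))"

definition vae_cost ::
  "nat \<Rightarrow> (nat \<Rightarrow> real^'d) \<Rightarrow> real^'k^'d \<Rightarrow> real^'d \<Rightarrow> real \<Rightarrow> real" where
  "vae_cost n x W b l =
     (\<Sum>i<n. Omega (x i) W b (mat l)) + real n * ln (det (mat l + W ** transpose W))"

definition vae_cost_sep ::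
  "nat \<Rightarrow> (nat \<Rightarrow> real^'d) \<Rightarrow> real^'k^'d \<Rightarrow> real^'d \<Rightarrow> real \<Rightarrow> real" where
  "vae_cost_sep n x W b l =
     (\<Sum>i<n. Omega (x i) W b (mat l))
     + real n * ((\<Sum>j\<in>UNIV. ln (l + (norm (column j W))\<^sup>2))
                 + (real CARD('d) - real CARD('k)) * ln l)"

end

theory Submission
  imports Defs
begin

text \<open>With \<open>q = N(\<mu>, S S\<^sup>T)\<close>, twice the cost of one sample \<open>y\<close> splits, up to constants, into a mean part
  \<open>\<bar>\<mu>\<bar>\<^sup>2 + \<bar>y - b - W \<mu>\<bar>\<^sup>2 / l\<close> and a covariance part
  \<open>\<bar>S\<bar>\<^sup>2 + \<bar>W S\<bar>\<^sup>2 / l - ln (det S)\<^sup>2\<close> (Frobenius norms); it is infinite when \<open>S\<close> is singular.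
  Completing the square minimises the mean part, with value \<open>\<Omega>\<close>.  For the covariance part put
  \<open>M = I + W\<^sup>T W / l\<close> and choose \<open>A\<close> with \<open>A\<^sup>T M A = I\<close>; substituting \<open>S = A T\<close> leaves
  \<open>\<bar>T\<bar>\<^sup>2 - ln (det T)\<^sup>2 + ln (det M)\<close>, which is least at \<open>T = I\<close>.  Finally
  \<open>det (l I + W W\<^sup>T) = l\<^sup>d det M\<close>.  For diagonal covariance the covariance part is a sum of scalar terms,
  each handled by \<open>ln t \<le> t - 1\<close>.  The minimising mean is affine in \<open>y\<close> and the minimising \<open>S\<close> is
  constant, so the encoder class contains the optimum.\<close>

section \<open>Linear change of variables for the Lebesgue measure\<close>

lemma prod_Basis_vec: "(\<Prod>b\<in>(Basis :: (real^'n) set). F b) = (\<Prod>i\<in>UNIV. F (axis i 1))"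
  and sum_Basis_vec: "(\<Sum>b\<in>(Basis :: (real^'n) set). G b) = (\<Sum>i\<in>UNIV. G (axis i 1))"
proof -
  have B: "(Basis :: (real^'n) set) = range (\<lambda>i. axis i 1)"
    by (auto simp: Basis_vec_def)
  have inj: "inj (\<lambda>i::'n. axis i (1::real))"
    by (auto simp: inj_on_def axis_eq_axis)
  show "(\<Prod>b\<in>(Basis :: (real^'n) set). F b) = (\<Prod>i\<in>UNIV. F (axis i 1))"
    "(\<Sum>b\<in>(Basis :: (real^'n) set). G b) = (\<Sum>i\<in>UNIV. G (axis i 1))"
    unfolding B prod.reindex[OF inj] sum.reindex[OF inj] by (simp_all add: o_def)
qed

lemma measurable_vec_nth [measurable]: "(\<lambda>x :: real^'n. x $ i) \<in> borel_measurable borel"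
  by (intro borel_measurable_continuous_onI continuous_intros)

lemma borel_measurable_vec_lambda:
  assumes "\<And>i. (\<lambda>x. h x i) \<in> borel_measurable M"
  shows "(\<lambda>x. (\<chi> i. h x i) :: real^'n) \<in> borel_measurable M"
  unfolding borel_measurable_euclidean_space[where 'c = "real^'n"]
  using assms by (auto simp: Basis_vec_def inner_axis)

lemma borel_measurable_vec_lambda_PiM [measurable]:
  "(\<lambda>f. \<chi> i. f i) \<in> measurable (\<Pi>\<^sub>M i\<in>(UNIV::'n::finite set). lborel) (borel :: (real^'n) measure)"
  by (rule borel_measurable_vec_lambda) measurable

text \<open>Lebesgue measure is determined by its values on boxes, and the preimage of a box under
  the coordinate map is a product of intervals. The product form allows integrating one coordinate
  at a time.\<close>

lemma lborel_vec_eq_PiM: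
  "(lborel :: (real^'n) measure) = distr (\<Pi>\<^sub>M i\<in>UNIV. lborel) borel (\<lambda>f. \<chi> i. f i)"
proof (rule lborel_eqI)
  interpret product_sigma_finite "\<lambda>_::'n. lborel :: real measure" ..
  fix l u :: "real^'n"
  assume "\<And>b. b \<in> Basis \<Longrightarrow> l \<bullet> b \<le> u \<bullet> b"
  then have le: "l $ i \<le> u $ i" for i
    by (metis axis_in_Basis_iff cart_eq_inner_axis Basis_real_def singletonI)
  have "(\<lambda>f. \<chi> i. f i) -` box l u \<inter> space (\<Pi>\<^sub>M i\<in>(UNIV::'n set). lborel) = (\<Pi>\<^sub>E i\<in>UNIV. {l $ i<..<u $ i})"
    by (auto simp: mem_box_cart space_PiM PiE_def Pi_def)
  then have "emeasure (distr (\<Pi>\<^sub>M i\<in>(UNIV::'n set). lborel) borel (\<lambda>f. \<chi> i. f i)) (box l u)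
     = (\<Prod>i\<in>UNIV. ennreal (u $ i - l $ i))"
    using le by (simp add: emeasure_distr emeasure_PiM)
  also have "\<dots> = ennreal (\<Prod>i\<in>UNIV. u $ i - l $ i)"
    using le by (simp add: prod_ennreal)
  also have "(\<Prod>i\<in>UNIV. u $ i - l $ i) = (\<Prod>b\<in>Basis. (u - l) \<bullet> b)"
    by (simp add: prod_Basis_vec inner_axis)
  finally show "emeasure (distr (\<Pi>\<^sub>M i\<in>(UNIV::'n set). lborel) borel (\<lambda>f. \<chi> i. f i)) (box l u)
     = ennreal (\<Prod>b\<in>Basis. (u - l) \<bullet> b)" .
qed simp

lemma nn_integral_lborel_vec:
  fixes f :: "real^'n \<Rightarrow> ennreal"
  assumes [measurable]: "f \<in> borel_measurable borel"
  shows "(\<integral>\<^sup>+x. f x \<partial>lborel) = (\<integral>\<^sup>+y. f (\<chi> i. y i) \<partial>(\<Pi>\<^sub>M i\<in>UNIV. lborel))"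
  by (subst lborel_vec_eq_PiM) (simp add: nn_integral_distr)

lemma borel_measurable_matrix_vector_mult [measurable]:
  "(\<lambda>x. (A :: real^'n^'m) *v x) \<in> borel_measurable borel"
  by (intro borel_measurable_continuous_onI continuous_intros linear_continuous_on
      linear_conv_bounded_linear[THEN iffD1]) simp

lemma nn_integral_lborel_diagonal:
  fixes A :: "real^'n^'n" and f :: "real^'n \<Rightarrow> ennreal"
  assumes A: "\<And>i j. i \<noteq> j \<Longrightarrow> A $ i $ j = 0" and d: "det A \<noteq> 0"
    and [measurable]: "f \<in> borel_measurable borel"
  shows "(\<integral>\<^sup>+x. f x \<partial>lborel) = \<bar>det A\<bar> * (\<integral>\<^sup>+x. f (A *v x) \<partial>lborel)"
proof -
  have det: "det A = (\<Prod>i\<in>UNIV. A $ i $ i)"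
    by (rule det_diagonal[OF A])
  \<comment> \<open>\<open>lborel_affine_euclidean\<close> indexes scale factors by basis vectors;
    \<open>c\<close> sends \<open>axis i 1\<close> to the i-th diagonal entry.\<close>
  define c where "c b = (\<Sum>i\<in>UNIV. b $ i * A $ i $ i)" for b :: "real^'n"
  have c: "c (axis i 1) = A $ i $ i" for i
    by (simp add: c_def axis_def if_distrib[of "\<lambda>x. x * _"] cong: if_cong)
  have nz: "c b \<noteq> 0" if "b \<in> Basis" for b
    using that d by (auto simp: Basis_vec_def c det)
  have "(A *v x) $ i = A $ i $ i * x $ i" for x i
    by (simp add: matrix_vector_mult_def) (subst sum.remove[of _ i], auto simp: A intro!: sum.neutral)
  then have T: "0 + (\<Sum>j\<in>Basis. (c j * (x \<bullet> j)) *\<^sub>R j) = A *v x" for x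
    unfolding sum_Basis_vec
    by (simp add: vec_eq_iff c inner_axis) (simp add: axis_def if_distrib cong: if_cong)
  have "(lborel :: (real^'n) measure) = density (distr lborel borel (\<lambda>x. A *v x)) (\<lambda>_. \<bar>det A\<bar>)"
    using lborel_affine_euclidean[where c=c and t=0, OF nz]
    by (simp add: T prod_Basis_vec c det abs_prod del: add_0)
  then have "(\<integral>\<^sup>+x. f x \<partial>lborel) = (\<integral>\<^sup>+x. f x \<partial>density (distr lborel borel (\<lambda>x. A *v x)) (\<lambda>_. \<bar>det A\<bar>))"
    by simp
  then show ?thesis
    by (simp add: nn_integral_density nn_integral_distr nn_integral_cmult)
qed

text \<open>Swapping two coordinates turns a box into a box with the same side lengths in another
  order, so volume is preserved.\<close>

lemma nn_integral_lborel_transpose: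
  fixes f :: "real^'n \<Rightarrow> ennreal"
  assumes [measurable]: "f \<in> borel_measurable borel"
  shows "(\<integral>\<^sup>+x. f x \<partial>lborel) = (\<integral>\<^sup>+x. f (\<chi> i. x $ Transposition.transpose m n i) \<partial>lborel)"
proof -
  let ?t = "Transposition.transpose m n"
  let ?T = "\<lambda>x :: real^'n. (\<chi> i. x $ ?t i) :: real^'n"
  have [measurable]: "?T \<in> borel_measurable borel"
    by (rule borel_measurable_vec_lambda) measurable
  have "lborel = distr lborel borel ?T"
  proof (rule lborel_eqI)
    fix l u :: "real^'n"
    assume "\<And>b. b \<in> Basis \<Longrightarrow> l \<bullet> b \<le> u \<bullet> b"
    then have le: "l $ i \<le> u $ i" for i
      by (metis axis_in_Basis_iff cart_eq_inner_axis Basis_real_def singletonI)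
    have box: "?T -` box l u = box (?T l) (?T u)"
      by (auto simp: mem_box_cart) (metis transpose_involutory)+
    have "emeasure (distr lborel borel ?T) (box l u) = ennreal (\<Prod>b\<in>Basis. (?T u - ?T l) \<bullet> b)"
      using le by (simp add: emeasure_distr box emeasure_lborel_box_eq Basis_vec_def inner_axis)
    also have "(\<Prod>b\<in>Basis. (?T u - ?T l) \<bullet> b) = (\<Prod>i\<in>UNIV. (u - l) $ ?t i)"
      by (simp add: prod_Basis_vec inner_axis)
    also have "\<dots> = (\<Prod>b\<in>Basis. (u - l) \<bullet> b)"
      using prod.permute[OF permutes_swap_id, where S=UNIV and g="\<lambda>i. (u - l) $ i", symmetric, of m n]
      by (simp add: prod_Basis_vec inner_axis o_def)
    finally show "emeasure (distr lborel borel ?T) (box l u) = ennreal (\<Prod>b\<in>Basis. (u - l) \<bullet> b)" .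
  qed simp
  then have "(\<integral>\<^sup>+x. f x \<partial>lborel) = (\<integral>\<^sup>+x. f x \<partial>distr lborel borel ?T)"
    by simp
  then show ?thesis
    by (simp add: nn_integral_distr)
qed

text \<open>Integrate coordinate \<open>m\<close> first with the others frozen: the shear then only
  translates it by \<open>c * y n\<close>, which is constant because
  \<open>m \<noteq> n\<close>.\<close>

lemma nn_integral_lborel_shear:
  fixes f :: "real^'n \<Rightarrow> ennreal"
  assumes [measurable]: "f \<in> borel_measurable borel" and mn: "m \<noteq> n"
  shows "(\<integral>\<^sup>+x. f x \<partial>lborel) = (\<integral>\<^sup>+x. f (\<chi> i. if i = m then x $ m + c * x $ n else x $ i) \<partial>lborel)"
proof -
  interpret product_sigma_finite "\<lambda>_::'n. lborel :: real measure" ..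
  let ?T = "\<lambda>x :: real^'n. (\<chi> i. if i = m then x $ m + c * x $ n else x $ i) :: real^'n"
  have T[measurable]: "?T \<in> borel_measurable borel"
    by (rule borel_measurable_vec_lambda) (auto intro!: borel_measurable_add borel_measurable_times)
  have ins: "insert m (UNIV - {m}) = UNIV" by auto
  have split: "(\<integral>\<^sup>+x. g x \<partial>lborel)
     = (\<integral>\<^sup>+y. (\<integral>\<^sup>+t. g (\<chi> i. (y(m := t)) i) \<partial>lborel) \<partial>(\<Pi>\<^sub>M i\<in>UNIV - {m}. lborel))"
    if [measurable]: "g \<in> borel_measurable borel" for g :: "real^'n \<Rightarrow> ennreal"
  proof -
    have "(\<lambda>y. g (\<chi> i. y i)) \<in> borel_measurable (\<Pi>\<^sub>M i\<in>insert m (UNIV - {m}). lborel)"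
      unfolding ins by measurable
    from product_nn_integral_insert[OF _ _ this] show ?thesis
      by (simp add: ins nn_integral_lborel_vec)
  qed
  have "(\<integral>\<^sup>+t. f (?T (\<chi> i. (y(m := t)) i)) \<partial>lborel) = (\<integral>\<^sup>+t. f (\<chi> i. (y(m := t)) i) \<partial>lborel)" for y
  proof -
    have eq: "?T (\<chi> i. (y(m := t)) i) = (\<chi> i. (y(m := c * y n + 1 * t)) i)" for t
      using mn by (auto simp: vec_eq_iff)
    have [measurable]: "(\<lambda>t. (\<chi> i. (y(m := t)) i) :: real^'n) \<in> borel_measurable borel"
      by (rule borel_measurable_vec_lambda) auto
    show ?thesis
      unfolding eq by (subst (2) nn_integral_real_affine[where c=1 and t="c * y n"]) simp_all
  qed
  then show ?thesis
    by (subst (1 2) split) (simp_all only: assms T measurable_compose[OF T])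
qed

text \<open>Every square matrix is a product of matrices with a zero row, diagonal matrices, swaps
  and shears, and the formula passes to products because determinants multiply. A zero row is
  excluded by the determinant.\<close>

theorem nn_integral_lborel_linear:
  fixes A :: "real^'n^'n" and f :: "real^'n \<Rightarrow> ennreal"
  assumes "det A \<noteq> 0" and "f \<in> borel_measurable borel"
  shows "(\<integral>\<^sup>+x. f x \<partial>lborel) = \<bar>det A\<bar> * (\<integral>\<^sup>+x. f (A *v x) \<partial>lborel)"
proof -
  \<comment> \<open>The claim ranges over all \<open>f\<close> because in a product the second
    factor is applied to \<open>\<lambda>x. f (A *v x)\<close> rather than to
    \<open>f\<close>.\<close>
  have "det A \<noteq> 0 \<longrightarrow> (\<forall>f \<in> borel_measurable borel.
      (\<integral>\<^sup>+x. f x \<partial>lborel) = ennreal \<bar>det A\<bar> * (\<integral>\<^sup>+x. f (A *v x) \<partial>lborel))"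
  proof (induction A rule: induct_matrix_elementary)
    case (1 A B)
    show ?case
    proof safe
      fix f :: "real^'n \<Rightarrow> ennreal"
      assume f[measurable]: "f \<in> borel_measurable borel" and "det (A ** B) \<noteq> 0"
      then have nz: "det A \<noteq> 0" "det B \<noteq> 0" by (auto simp: det_mul)
      have "(\<integral>\<^sup>+x. f x \<partial>lborel) = ennreal \<bar>det A\<bar> * (\<integral>\<^sup>+x. f (A *v x) \<partial>lborel)"
        by (rule 1(1)[rule_format, OF nz(1) f])
      also have "(\<integral>\<^sup>+x. f (A *v x) \<partial>lborel) = ennreal \<bar>det B\<bar> * (\<integral>\<^sup>+x. f (A *v (B *v x)) \<partial>lborel)"
        by (rule 1(2)[rule_format, OF nz(2)]) measurable
      finally show "(\<integral>\<^sup>+x. f x \<partial>lborel) = ennreal \<bar>det (A ** B)\<bar> * (\<integral>\<^sup>+x. f (A ** B *v x) \<partial>lborel)"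
        by (simp add: det_mul abs_mult ennreal_mult matrix_vector_mul_assoc mult.assoc)
    qed
  next
    case (2 A i)
    then show ?case by (simp add: det_zero_row)
  next
    case (3 A)
    then show ?case using nn_integral_lborel_diagonal[of A] by blast
  next
    case (4 m n)
    let ?A = "\<chi> i j. mat 1 $ i $ Transposition.transpose m n j :: real^'n^'n"
    have "\<bar>det ?A\<bar> = 1"
      by (simp add: det_permute_columns permutes_swap_id sign_swap_id abs_mult)
    moreover have "?A *v x = (\<chi> i. x $ Transposition.transpose m n i)" for x
    proof -
      have "(mat 1 :: real^'n^'n) $ i $ Transposition.transpose m n j
          = (if j = Transposition.transpose m n i then 1 else 0)" for i j
        by (auto simp: mat_def)
      then show ?thesis
        by (simp add: vec_eq_iff matrix_vector_mult_def if_distrib[of "\<lambda>y. y * _"] cong: if_cong)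
    qed
    ultimately show ?case
      using nn_integral_lborel_transpose[of _ m n] by simp
  next
    case (5 m n c)
    let ?A = "\<chi> i j. if i = m \<and> j = n then c else of_bool (i = j) :: real^'n^'n"
    have "?A = (\<chi> k. if k = m then row m (mat 1) + c *s row n (mat 1) else row k (mat 1))"
      using 5 by (auto simp: vec_eq_iff row_def mat_def)
    then have "det ?A = 1"
      using det_row_operation[OF 5, of "mat 1" c] by simp
    moreover have "?A *v x = (\<chi> i. if i = m then x $ m + c * x $ n else x $ i)" for x
    proof -
      have "(if i = m \<and> j = n then c else of_bool (i = j)) * x $ j
          = (if j = i then x $ j else 0) + (if j = n then if i = m then c * x $ n else 0 else 0)" for i j
        using 5 by auto
      then show ?thesis
        by (auto simp: vec_eq_iff matrix_vector_mult_def sum.distrib)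
    qed
    ultimately show ?case
      using nn_integral_lborel_shear[OF _ 5, of _ c] by simp
  qed
  then show ?thesis using assms by blast
qed

section \<open>The standard Gaussian\<close>

lemma matrix_inv_eqI:
  fixes A B :: "real^'n^'n"
  assumes "A ** B = mat 1"
  shows "matrix_inv A = B"
  unfolding matrix_inv_def
proof (rule some_equality)
  show "A ** B = mat 1 \<and> B ** A = mat 1"
    using assms matrix_left_right_inverse by blast
  show "C = B" if "A ** C = mat 1 \<and> C ** A = mat 1" for C
    by (metis assms matrix_mul_assoc matrix_mul_lid matrix_mul_rid that)
qed

lemma matrix_inv_mat_1 [simp]: "matrix_inv (mat 1 :: real^'n^'n) = mat 1"
  by (rule matrix_inv_eqI) simp

lemma invertible_mat_1 [simp]: "invertible (mat 1 :: real^'n^'n)"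
  by (simp add: invertible_det_nz)

lemma matrix_vector_inner: "((A :: real^'n^'m) *v x) \<bullet> y = x \<bullet> (transpose A *v y)"
  by (metis dot_lmul_matrix transpose_matrix_vector transpose_transpose)

lemma inner_congruence:
  fixes A :: "real^'n^'m" and P :: "real^'m^'m"
  shows "(A *v x) \<bullet> (P *v (A *v x)) = x \<bullet> ((transpose A ** P ** A) *v x)"
  by (simp add: matrix_vector_inner matrix_vector_mul_assoc matrix_mul_assoc del: transpose_matrix_vector)

lemma nn_integral_lborel_matrix_affine:
  fixes A :: "real^'n^'n" and f :: "real^'n \<Rightarrow> ennreal"
  assumes "det A \<noteq> 0" and [measurable]: "f \<in> borel_measurable borel"
  shows "(\<integral>\<^sup>+x. f x \<partial>lborel) = \<bar>det A\<bar> * (\<integral>\<^sup>+x. f (t + A *v x) \<partial>lborel)"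
proof -
  have "(\<integral>\<^sup>+x. f x \<partial>lborel) = (\<integral>\<^sup>+x. f x \<partial>distr lborel borel ((+) t))"
    by (simp add: lborel_distr_plus)
  also have "\<dots> = (\<integral>\<^sup>+x. f (t + x) \<partial>lborel)"
    by (simp add: nn_integral_distr)
  also have "\<dots> = \<bar>det A\<bar> * (\<integral>\<^sup>+x. f (t + A *v x) \<partial>lborel)"
    using assms by (intro nn_integral_lborel_linear) auto
  finally show ?thesis .
qed

section \<open>Moments of the standard Gaussian and the general Gaussian integral\<close>

lemma has_bochner_integral_lborel_vec_prod:
  fixes f :: "'n::finite \<Rightarrow> real \<Rightarrow> real"
  assumes f: "\<And>i. has_bochner_integral lborel (f i) (I i)"
  shows "has_bochner_integral lborel (\<lambda>x :: real^'n. \<Prod>i\<in>UNIV. f i (x $ i)) (\<Prod>i\<in>UNIV. I i)"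
proof -
  interpret product_sigma_finite "\<lambda>_::'n. lborel :: real measure" ..
  have int: "integrable lborel (f i)" and I: "(\<integral>x. f i x \<partial>lborel) = I i" for i
    using f[of i] by (auto simp: has_bochner_integral_iff)
  have [measurable]: "f i \<in> borel_measurable borel" for i
    using int[of i] by (auto dest: borel_measurable_integrable)
  have "has_bochner_integral (\<Pi>\<^sub>M i\<in>UNIV. lborel) (\<lambda>y. \<Prod>i\<in>UNIV. f i (y i)) (\<Prod>i\<in>UNIV. I i)"
    using product_integrable_prod[OF finite_class.finite_UNIV int]
      product_integral_prod[OF finite_class.finite_UNIV int]
    by (simp add: has_bochner_integral_iff I)
  then show ?thesis
    by (subst lborel_vec_eq_PiM) (intro has_bochner_integral_distr; simp)
qed

definition std_gaussian :: "(real^'n) measure" where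
  "std_gaussian = density lborel (\<lambda>u. ennreal (mvn_density 0 (mat 1) u))"

lemma mvn_std: "mvn 0 (mat 1) = std_gaussian"
  by (simp add: mvn_def std_gaussian_def)

lemma space_std_gaussian [simp]: "space std_gaussian = UNIV"
  and sets_std_gaussian [simp, measurable_cong]: "sets std_gaussian = sets borel"
  by (simp_all add: std_gaussian_def)

lemma borel_measurable_mvn_density [measurable]: "mvn_density \<mu> \<Sigma> \<in> borel_measurable borel"
  unfolding mvn_density_def[abs_def] by measurable

lemma mvn_density_nonneg [simp]: "0 \<le> det \<Sigma> \<Longrightarrow> 0 \<le> mvn_density \<mu> \<Sigma> y"
  by (simp add: mvn_density_def)

lemma mvn_density_std:
  "mvn_density 0 (mat 1) (u :: real^'n) = exp (- (u \<bullet> u) / 2) / sqrt ((2 * pi) ^ CARD('n))"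
  by (simp add: mvn_density_def)

lemma mvn_density_std_prod:
  "mvn_density 0 (mat 1) (u :: real^'n) = (\<Prod>i\<in>UNIV. std_normal_density (u $ i))"
proof -
  have "(\<Prod>i\<in>UNIV. std_normal_density (u $ i)) = (1 / sqrt (2 * pi)) ^ CARD('n) * exp (\<Sum>i\<in>UNIV. - (u $ i)\<^sup>2 / 2)"
    by (simp only: std_normal_density_def prod.distrib prod_constant exp_sum finite_class.finite_UNIV)
  also have "(\<Sum>i\<in>UNIV. - (u $ i)\<^sup>2 / 2) = - (u \<bullet> u) / 2"
    by (simp only: inner_vec_def inner_real_def power2_eq_square sum_negf[symmetric] sum_divide_distrib)
  also have "(1 / sqrt (2 * pi)) ^ CARD('n) = 1 / sqrt ((2 * pi) ^ CARD('n))"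
    by (simp only: power_divide power_one real_sqrt_power)
  finally show ?thesis
    by (simp only: mvn_density_std) simp
qed

lemma has_bochner_integral_std_normal_moments:
  "has_bochner_integral lborel (\<lambda>x. std_normal_density x * x ^ 0) 1"
  "has_bochner_integral lborel (\<lambda>x. std_normal_density x * x ^ 1) 0"
  "has_bochner_integral lborel (\<lambda>x. std_normal_density x * x ^ 2) 1"
  using std_normal_moment_even[of 0] std_normal_moment_odd[of 0] std_normal_moment_even[of 1]
  by simp_all

text \<open>The integral of a monomial factorises into one-dimensional moments of order 0, 1 and 2,
  which are 1, 0 and 1; so it vanishes exactly when some exponent is 1.\<close>

lemma has_bochner_integral_std_gaussian:
  fixes k :: "'n::finite \<Rightarrow> nat"
  assumes "\<And>i. k i \<le> 2"
  shows "has_bochner_integral std_gaussian (\<lambda>u :: real^'n. \<Prod>i\<in>UNIV. (u $ i) ^ k i)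
    (if \<exists>i. k i = 1 then 0 else 1)"
proof -
  have k: "k i = 0 \<or> k i = 1 \<or> k i = 2" for i
    using assms[of i] by linarith
  have "has_bochner_integral lborel (\<lambda>x. std_normal_density x * x ^ k i) (if k i = 1 then 0 else 1)" for i
    using k[of i] has_bochner_integral_std_normal_moments by (elim disjE) simp_all
  from has_bochner_integral_lborel_vec_prod[OF this]
  have "has_bochner_integral lborel (\<lambda>u :: real^'n. mvn_density 0 (mat 1) u *\<^sub>R (\<Prod>i\<in>UNIV. (u $ i) ^ k i))
      (\<Prod>i\<in>UNIV. if k i = 1 then 0 else 1)"
    by (simp add: mvn_density_std_prod prod.distrib)
  moreover have "(\<Prod>i\<in>UNIV. if k i = 1 then 0 else 1) = (if \<exists>i. k i = 1 then 0 else 1 :: real)"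
    by (auto intro: prod.neutral)
  ultimately show ?thesis
    unfolding std_gaussian_def by (intro has_bochner_integral_density) auto
qed

lemma prob_space_std_gaussian: "prob_space (std_gaussian :: (real^'n) measure)"
proof
  have int: "has_bochner_integral std_gaussian (\<lambda>u :: real^'n. 1 :: real) 1"
    using has_bochner_integral_std_gaussian[of "\<lambda>_::'n. 0"] by simp
  then have "(\<integral>\<^sup>+u. ennreal 1 \<partial>(std_gaussian :: (real^'n) measure)) = ennreal 1"
    by (subst nn_integral_eq_integral) (auto simp: has_bochner_integral_iff)
  then show "emeasure (std_gaussian :: (real^'n) measure) (space std_gaussian) = 1"
    by simp
qed

lemma std_gaussian_const: "has_bochner_integral std_gaussian (\<lambda>u :: real^'n. a :: real) a"
proof -
  interpret prob_space "std_gaussian :: (real^'n) measure" by (rule prob_space_std_gaussian)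
  show ?thesis
    using prob_space by (simp add: has_bochner_integral_iff)
qed

text \<open>Indicator exponents write a single coordinate as a monomial, so that the moment formula
  for monomials applies to it.\<close>

lemma prod_power_of_bool: "(\<Prod>l\<in>UNIV. (u l :: real) ^ (of_bool (l = i) :: nat)) = u (i :: 'n::finite)"
  by (subst prod.remove[of _ i]) (auto intro!: prod.neutral)

lemma std_gaussian_mean: "has_bochner_integral std_gaussian (\<lambda>u :: real^'n. u $ i) 0"
proof -
  have "has_bochner_integral std_gaussian (\<lambda>u :: real^'n. \<Prod>l\<in>UNIV. (u $ l) ^ (of_bool (l = i) :: nat))
    (if \<exists>l. of_bool (l = i) = (1::nat) then 0 else 1)"
    by (rule has_bochner_integral_std_gaussian) simp
  moreover have "\<exists>l. of_bool (l = i) = (1::nat)"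
    by (intro exI[of _ i]) simp
  ultimately show ?thesis
    unfolding prod_power_of_bool by presburger
qed

lemma std_gaussian_cov:
  "has_bochner_integral std_gaussian (\<lambda>u :: real^'n. u $ i * u $ j) (of_bool (i = j))"
proof -
  \<comment> \<open>The exponents add up to 2 at \<open>i\<close> if \<open>i = j\<close>; otherwise
    they are 1 at each of the two indices.\<close>
  have "has_bochner_integral std_gaussian
      (\<lambda>u :: real^'n. \<Prod>l\<in>UNIV. (u $ l) ^ (of_bool (l = i) + of_bool (l = j)))
      (if \<exists>l. of_bool (l = i) + of_bool (l = j) = (1::nat) then 0 else 1)"
    by (rule has_bochner_integral_std_gaussian) (simp add: of_bool_def)
  moreover have "(if \<exists>l. of_bool (l = i) + of_bool (l = j) = (1::nat) then 0 else 1) = (of_bool (i = j) :: real)"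
    by (cases "i = j") (auto simp: of_bool_def)
  ultimately show ?thesis
    unfolding power_add prod.distrib prod_power_of_bool by presburger
qed

lemma norm_matrix_sq: "(norm (T :: real^'n^'m))\<^sup>2 = (\<Sum>i\<in>UNIV. \<Sum>j\<in>UNIV. (T $ i $ j)\<^sup>2)"
  unfolding power2_norm_eq_inner by (simp add: inner_vec_def power2_eq_square)

lemma norm_mat_1: "(norm (mat 1 :: real^'n^'n))\<^sup>2 = CARD('n)"
  unfolding norm_matrix_sq by (simp add: mat_def if_distrib[of "\<lambda>x. x\<^sup>2"] cong: if_cong)

text \<open>The cross term has mean zero, and E[u_j u_k] = \<open>of_bool (j = k)\<close> leaves the
  sum of squared entries, which is the squared (Frobenius) norm of \<open>T\<close>. The later
  expectations of quadratic functions reduce to this formula.\<close>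

lemma std_gaussian_norm_affine:
  fixes T :: "real^'n^'m"
  shows "has_bochner_integral std_gaussian (\<lambda>u. (norm (c + T *v u))\<^sup>2) ((norm c)\<^sup>2 + (norm T)\<^sup>2)"
proof -
  interpret prob_space "std_gaussian :: (real^'n) measure" by (rule prob_space_std_gaussian)
  \<comment> \<open>Integrand and value are spelled out in the shape that the linearity rules
    produce; both are simplified afterwards.\<close>
  have "has_bochner_integral std_gaussian
     (\<lambda>u. \<Sum>i\<in>UNIV. ((c $ i)\<^sup>2 + 2 * c $ i * (\<Sum>j\<in>UNIV. T $ i $ j * u $ j))
          + (\<Sum>j\<in>UNIV. \<Sum>k\<in>UNIV. T $ i $ j * T $ i $ k * (u $ j * u $ k)))
     (\<Sum>i\<in>UNIV. ((c $ i)\<^sup>2 * measure std_gaussian (space std_gaussian :: (real^'n) set) + 2 * c $ i * (\<Sum>j\<in>UNIV. T $ i $ j * 0))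
          + (\<Sum>j\<in>UNIV. \<Sum>k\<in>UNIV. T $ i $ j * T $ i $ k * of_bool (j = k)))"
    by (intro has_bochner_integral_sum has_bochner_integral_add has_bochner_integral_mult_right
        std_gaussian_mean std_gaussian_cov)
      (simp add: has_bochner_integral_iff prob_space)
  moreover have "(\<Sum>i\<in>UNIV. ((c $ i)\<^sup>2 + 2 * c $ i * (\<Sum>j\<in>UNIV. T $ i $ j * u $ j))
          + (\<Sum>j\<in>UNIV. \<Sum>k\<in>UNIV. T $ i $ j * T $ i $ k * (u $ j * u $ k))) = (norm (c + T *v u))\<^sup>2" for u
  proof -
    have "(\<Sum>j\<in>UNIV. \<Sum>k\<in>UNIV. T $ i $ j * T $ i $ k * (u $ j * u $ k)) = (\<Sum>j\<in>UNIV. T $ i $ j * u $ j)\<^sup>2" for i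
      by (simp add: power2_eq_square sum_product mult_ac)
    then show ?thesis
      unfolding power2_norm_eq_inner
      by (simp add: inner_vec_def matrix_vector_mult_def power2_sum algebra_simps flip: power2_eq_square)
  qed
  moreover have "(\<Sum>i\<in>UNIV. ((c $ i)\<^sup>2 * measure std_gaussian (space std_gaussian :: (real^'n) set) + 2 * c $ i * (\<Sum>j\<in>UNIV. T $ i $ j * 0))
          + (\<Sum>j\<in>UNIV. \<Sum>k\<in>UNIV. T $ i $ j * T $ i $ k * of_bool (j = k))) = (norm c)\<^sup>2 + (norm T)\<^sup>2"
    unfolding norm_matrix_sq power2_norm_eq_inner[of c] using prob_space
    by (simp add: inner_vec_def power2_eq_square sum.distrib)
  ultimately show ?thesis
    by simp
qed

text \<open>The substitution z = c + A u turns the quadratic form into u . u, with Jacobian |det A|.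
  The factor \<open>A\<close> takes the place of an inverse square root of \<open>P\<close>.\<close>

lemma nn_integral_gaussian:
  fixes A P :: "real^'n^'n"
  assumes AP: "transpose A ** P ** A = mat 1"
  shows "(\<integral>\<^sup>+z. ennreal (exp (- ((z - c) \<bullet> (P *v (z - c))) / 2)) \<partial>(lborel :: (real^'n) measure))
    = ennreal (\<bar>det A\<bar> * sqrt ((2 * pi) ^ CARD('n)))"
proof -
  have d: "det A \<noteq> 0"
    using arg_cong[OF AP, of det] by (auto simp: det_mul)
  let ?K = "sqrt ((2 * pi) ^ CARD('n))"
  have K: "?K > 0" by simp
  \<comment> \<open>The normalising constant is read off from the total mass 1 of the standard
    Gaussian.\<close>
  have "1 = emeasure std_gaussian (space std_gaussian :: (real^'n) set)"
    by (rule prob_space.emeasure_space_1[OF prob_space_std_gaussian, symmetric])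
  also have "\<dots> = (\<integral>\<^sup>+u. ennreal (mvn_density 0 (mat 1) u) \<partial>(lborel :: (real^'n) measure))"
    unfolding space_std_gaussian unfolding std_gaussian_def by (simp add: emeasure_density)
  finally have one: "(\<integral>\<^sup>+u. ennreal (mvn_density 0 (mat 1) u) \<partial>(lborel :: (real^'n) measure)) = 1" ..
  have "(\<integral>\<^sup>+u. ennreal (exp (- (u \<bullet> u) / 2)) \<partial>(lborel :: (real^'n) measure))
      = (\<integral>\<^sup>+u. ennreal ?K * ennreal (mvn_density 0 (mat 1) u) \<partial>(lborel :: (real^'n) measure))"
    using K by (subst ennreal_mult[symmetric]) (simp_all only: mvn_density_std, simp_all)
  also have "\<dots> = ennreal ?K"
    by (simp add: nn_integral_cmult one)
  finally have std: "(\<integral>\<^sup>+u. ennreal (exp (- (u \<bullet> u) / 2)) \<partial>(lborel :: (real^'n) measure)) = ennreal ?K" .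
  have "(\<integral>\<^sup>+z. ennreal (exp (- ((z - c) \<bullet> (P *v (z - c))) / 2)) \<partial>(lborel :: (real^'n) measure))
    = \<bar>det A\<bar> * (\<integral>\<^sup>+u. ennreal (exp (- ((c + A *v u - c) \<bullet> (P *v (c + A *v u - c))) / 2)) \<partial>(lborel :: (real^'n) measure))"
    by (rule nn_integral_lborel_matrix_affine[OF d]) measurable
  also have "\<dots> = ennreal \<bar>det A\<bar> * ennreal ?K"
    by (simp only: add_diff_cancel_left' inner_congruence AP matrix_vector_mul_lid std)
  finally show ?thesis
    by (simp only: ennreal_mult[OF abs_ge_zero less_imp_le[OF K]])
qed

section \<open>Positive definite matrices\<close>

definition posdef :: "real^'n^'n \<Rightarrow> bool" where
  "posdef P \<longleftrightarrow> transpose P = P \<and> (\<forall>v. v \<noteq> 0 \<longrightarrow> 0 < v \<bullet> (P *v v))"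

lemma transpose_add: "transpose (A + B :: real^'n^'m) = transpose A + transpose B"
  by (simp add: transpose_def vec_eq_iff)

lemma mat_vector_mult: "mat l *v (x :: real^'n) = l *\<^sub>R x"
  by (simp add: vec_eq_iff matrix_vector_mult_def mat_def if_distrib[of "\<lambda>y. y * _"] cong: if_cong)

lemma mat_mult_mat: "(mat a :: real^'n^'n) ** mat b = mat (a * b)"
  by (simp add: matrix_eq mat_vector_mult flip: matrix_vector_mul_assoc)

lemma det_mat: "det (mat l :: real^'n^'n) = l ^ CARD('n)"
  by (subst det_diagonal) (simp_all add: mat_def)

lemma inner_gram:
  fixes W :: "real^'n^'m"
  shows "v \<bullet> ((transpose W ** W) *v v) = (norm (W *v v))\<^sup>2"
  by (simp add: power2_norm_eq_inner matrix_vector_inner matrix_vector_mul_assoc del: transpose_matrix_vector)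

text \<open>The quadratic form is a |v|^2 + c |W v|^2. It is applied with \<open>a = 1\<close>,
  \<open>c = 1 / l\<close> to the posterior precision, and with \<open>transpose W\<close> for
  \<open>W\<close>, \<open>a = l\<close>, \<open>c = 1\<close> to the marginal covariance of the
  data.\<close>

lemma posdef_scalar_plus_gram:
  fixes W :: "real^'n^'m"
  assumes "0 < a" "0 \<le> c"
  shows "posdef (mat a + c *\<^sub>R (transpose W ** W))"
  unfolding posdef_def
proof (intro conjI allI impI)
  show "transpose (mat a + c *\<^sub>R (transpose W ** W)) = mat a + c *\<^sub>R (transpose W ** W)"
    by (simp add: transpose_add transpose_scalar matrix_transpose_mul)
  fix v :: "real^'n" assume "v \<noteq> 0"
  then have "0 < a * (v \<bullet> v)" using assms by simp
  then show "0 < v \<bullet> ((mat a + c *\<^sub>R (transpose W ** W)) *v v)"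
    using assms
    by (simp add: matrix_vector_mult_add_rdistrib mat_vector_mult inner_add_right inner_gram
        flip: scaleR_matrix_vector_assoc) (simp add: add_pos_nonneg)
qed

lemma matrix_entry: "(A :: real^'n^'m) $ i $ j = axis i 1 \<bullet> (A *v axis j 1)"
  by (simp add: inner_axis' matrix_vector_mult_basis column_def)

text \<open>Gram-Schmidt for the inner product x . P y. For a proper subset of the indices the
  vectors \<open>P *v a i\<close> span a proper subspace; a nonzero vector orthogonal to it has
  positive P-norm, and rescaling it extends the system.\<close>

lemma posdef_orthonormal_system:
  fixes P :: "real^'n^'n"
  assumes "posdef P"
  shows "\<exists>a. \<forall>i\<in>J. \<forall>j\<in>J. a i \<bullet> (P *v a j) = of_bool (i = (j :: 'n))"
proof (induction J rule: finite_induct[OF finite])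
  case (2 k J)
  then obtain a where a: "\<And>i j. i \<in> J \<Longrightarrow> j \<in> J \<Longrightarrow> a i \<bullet> (P *v a j) = of_bool (i = j)"
    by blast
  have "dim (span ((\<lambda>i. P *v a i) ` J)) \<le> card J"
    unfolding dim_span by (rule order_trans[OF dim_le_card' card_image_le]) auto
  \<comment> \<open>The new index \<open>k\<close> lies outside \<open>J\<close>, so
    \<open>J\<close> is a proper subset of the index type.\<close>
  also have "card J < DIM(real^'n)"
    using 2 by (auto simp: intro!: psubset_card_mono)
  finally obtain v where v: "v \<noteq> 0" "\<And>y. y \<in> span ((\<lambda>i. P *v a i) ` J) \<Longrightarrow> orthogonal v y"
    using orthogonal_to_subspace_exists[of "(\<lambda>i. P *v a i) ` J"] by auto
  have q: "v \<bullet> (P *v v) > 0" using assms v by (simp add: posdef_def)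
  define w where "w = (1 / sqrt (v \<bullet> (P *v v))) *\<^sub>R v"
  have ww: "w \<bullet> (P *v w) = 1"
    using q by (simp add: w_def matrix_vector_mult_scaleR)
  have wa: "w \<bullet> (P *v a j) = 0" if "j \<in> J" for j
  proof -
    have "orthogonal v (P *v a j)"
      using that by (intro v span_base) auto
    then show ?thesis by (simp add: w_def orthogonal_def)
  qed
  \<comment> \<open>The product in the other order vanishes by symmetry of \<open>P\<close>.\<close>
  have aw: "a j \<bullet> (P *v w) = 0" if "j \<in> J" for j
    using wa[OF that] assms
    by (metis inner_commute matrix_vector_inner posdef_def)
  show ?case
    by (intro exI[of _ "a(k := w)"]) (use 2 a ww wa aw in auto)
qed auto

text \<open>A P-orthonormal system indexed by the whole type supplies the columns of
  \<open>A\<close>.\<close>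

lemma posdef_diagonalize:
  fixes P :: "real^'n^'n"
  assumes "posdef P"
  obtains A :: "real^'n^'n" where "transpose A ** P ** A = mat 1"
proof -
  obtain a where a: "\<And>i j :: 'n. a i \<bullet> (P *v a j) = of_bool (i = j)"
    using posdef_orthonormal_system[OF assms, of UNIV] by auto
  define A :: "real^'n^'n" where "A = (\<chi> i j. a j $ i)"
  have A: "A *v axis j 1 = a j" for j
    by (simp add: A_def matrix_vector_mult_basis column_def vec_eq_iff)
  have "(transpose A ** P ** A) $ i $ j = a i \<bullet> (P *v a j)" for i j
  proof -
    have "(transpose A ** P ** A) $ i $ j = axis i 1 \<bullet> (transpose A *v (P *v (A *v axis j 1)))"
      by (simp only: matrix_entry matrix_vector_mul_assoc matrix_mul_assoc)
    also have "\<dots> = (A *v axis i 1) \<bullet> (P *v (A *v axis j 1))"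
      by (simp only: matrix_vector_inner)
    finally show ?thesis by (simp only: A)
  qed
  then have "transpose A ** P ** A = mat 1"
    by (simp add: a vec_eq_iff mat_def)
  then show ?thesis by (rule that)
qed

text \<open>One-sided inverses of square matrices are two-sided, so A^T (P A) = I gives P A A^T = I;
  inverse and determinant follow.\<close>

lemma diagonalize_inverse:
  fixes P A :: "real^'n^'n"
  assumes "transpose A ** P ** A = mat 1"
  shows "P ** (A ** transpose A) = mat 1" and "matrix_inv P = A ** transpose A"
    and "det P * (det A)\<^sup>2 = 1"
proof -
  have "transpose A ** (P ** A) = mat 1"
    using assms by (simp add: matrix_mul_assoc)
  then have "P ** A ** transpose A = mat 1"
    by (rule matrix_left_right_inverse1)
  then show *: "P ** (A ** transpose A) = mat 1"
    by (simp add: matrix_mul_assoc)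
  then show "matrix_inv P = A ** transpose A"
    by (rule matrix_inv_eqI)
  show "det P * (det A)\<^sup>2 = 1"
    using arg_cong[OF *, of det] by (simp add: det_mul power2_eq_square)
qed

text \<open>If A^T P A = I then P^-1 = A A^T, which is whitened by the transpose of A^-1. Its
  squared determinant is det P because det P (det A)^2 = 1.\<close>

lemma posdef_inverse_diagonalize:
  fixes P :: "real^'n^'n"
  assumes "posdef P"
  obtains B :: "real^'n^'n" where "transpose B ** matrix_inv P ** B = mat 1" "(det B)\<^sup>2 = det P"
proof -
  obtain A :: "real^'n^'n" where A: "transpose A ** P ** A = mat 1"
    using posdef_diagonalize[OF assms] .
  note inv = diagonalize_inverse[OF A]
  have d: "det A \<noteq> 0" using inv(3) by auto
  then obtain R where R: "A ** R = mat 1" "R ** A = mat 1"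
    by (metis invertible_def invertible_det_nz)
  have "R ** (A ** transpose A) ** transpose R = (R ** A) ** transpose (R ** A)"
    by (simp add: matrix_transpose_mul matrix_mul_assoc)
  then have "transpose (transpose R) ** matrix_inv P ** transpose R = mat 1"
    by (simp add: inv R)
  moreover have "(det (transpose R))\<^sup>2 = det P"
  proof -
    have "det A * det R = 1" using arg_cong[OF R(1), of det] by (simp add: det_mul)
    then have "det P = det P * (det A * det R)\<^sup>2" by simp
    also have "\<dots> = (det P * (det A)\<^sup>2) * (det R)\<^sup>2" by (simp add: power_mult_distrib)
    also have "\<dots> = (det (transpose R))\<^sup>2" by (simp only: inv(3)) simp
    finally show ?thesis ..
  qed
  ultimately show ?thesis by (rule that)
qed

text \<open>With K = l I + W W^T, s = K^-1 r and m = W^T s one has r = l s + W m. For z = m + e the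
  residual r - W z becomes l s - W e, and s . W e = m . e makes the cross terms of the two squares
  cancel. Thus m minimises over z, with minimum r . s.\<close>

lemma posterior_square_completion:
  fixes W :: "real^'k^'d" and r :: "real^'d"
  assumes l: "l > 0"
  defines "s \<equiv> matrix_inv (mat l + W ** transpose W) *v r"
  shows "(norm z)\<^sup>2 + (norm (r - W *v z))\<^sup>2 / l
    = r \<bullet> s + ((norm (z - transpose W *v s))\<^sup>2 + (norm (W *v (z - transpose W *v s)))\<^sup>2 / l)"
proof -
  let ?K = "mat l + W ** transpose W"
  define m where "m = transpose W *v s"
  define e where "e = z - m"
  have "posdef ?K"
    using posdef_scalar_plus_gram[OF l, of 1 "transpose W"] by simp
  then obtain A :: "real^'d^'d" where "transpose A ** ?K ** A = mat 1"
    using posdef_diagonalize by blast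
  from diagonalize_inverse[OF this] have "?K *v s = r"
    by (simp add: s_def matrix_vector_mul_assoc)
  then have r: "r = l *\<^sub>R s + W *v m"
    by (simp add: m_def matrix_vector_mult_add_rdistrib mat_vector_mult matrix_vector_mul_assoc
        del: transpose_matrix_vector)
  have z: "z = m + e" by (simp add: e_def)
  have Wm: "s \<bullet> (W *v y) = m \<bullet> y" for y
    by (metis m_def inner_commute matrix_vector_inner)
  have rz: "r - W *v z = l *\<^sub>R s - W *v e"
    by (simp add: r z matrix_vector_right_distrib)
  have "(norm (r - W *v z))\<^sup>2 / l = l * (s \<bullet> s) - 2 * (m \<bullet> e) + (norm (W *v e))\<^sup>2 / l"
    using l unfolding rz power2_norm_eq_inner
    by (simp add: inner_diff_left inner_diff_right inner_commute[of "W *v e" s] Wm field_simps)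
  moreover have "(norm z)\<^sup>2 = m \<bullet> m + 2 * (m \<bullet> e) + (norm e)\<^sup>2"
    unfolding power2_norm_eq_inner z by (simp add: inner_add_left inner_add_right inner_commute)
  moreover have "r \<bullet> s = l * (s \<bullet> s) + m \<bullet> m"
    unfolding r by (simp add: inner_add_left Wm inner_commute[of "W *v m"])
  ultimately show ?thesis
    unfolding m_def[symmetric] e_def[symmetric] by simp
qed

text \<open>For \<open>l > 0\<close> the matrix is the posterior precision of z given the data; its
  form is the excess left by completing the square.\<close>

lemma posterior_precision_quadratic_form:
  fixes W :: "real^'k^'d"
  shows "v \<bullet> ((mat 1 + (1 / l) *\<^sub>R (transpose W ** W)) *v v) = (norm v)\<^sup>2 + (norm (W *v v))\<^sup>2 / l"
  by (simp add: matrix_vector_mult_add_rdistrib inner_add_right power2_norm_eq_inner[of v] inner_gram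
        flip: scaleR_matrix_vector_assoc)

section \<open>Gaussian integrals and determinants\<close>

text \<open>Integrating the unnormalised joint Gaussian density of \<open>x\<close> and \<open>z\<close> in either order yields the identity.\<close>

lemma det_scalar_plus_gram_swap:
  fixes W :: "real^'k^'d"
  assumes l: "l > 0"
  shows "det (mat l + W ** transpose W) = l ^ CARD('d) * det (mat 1 + (1 / l) *\<^sub>R (transpose W ** W))"
proof -
  let ?K = "mat l + W ** transpose W" and ?M = "mat 1 + (1 / l) *\<^sub>R (transpose W ** W)"
  let ?s = "sqrt l"
  define cd ck where "cd = sqrt ((2 * pi) ^ CARD('d))" and "ck = sqrt ((2 * pi) ^ CARD('k))"
  have c: "0 < cd" "0 < ck" by (simp_all add: cd_def ck_def)
  obtain A :: "real^'k^'k" where A: "transpose A ** ?M ** A = mat 1"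
    using posdef_diagonalize[OF posdef_scalar_plus_gram[of 1 "1 / l" W]] l by auto
  have "posdef ?K"
    using posdef_scalar_plus_gram[OF l, of 1 "transpose W"] by simp
  then obtain B :: "real^'d^'d" where B: "transpose B ** matrix_inv ?K ** B = mat 1" "(det B)\<^sup>2 = det ?K"
    by (rule posdef_inverse_diagonalize)
  \<comment> \<open>Given z, the data have precision (1 / l) I, which is whitened by sqrt l times
    the identity.\<close>
  have S: "transpose (mat ?s) ** mat (1 / l) ** mat ?s = (mat 1 :: real^'d^'d)"
    using l by (simp add: mat_mult_mat)
  have I: "transpose (mat 1) ** mat 1 ** mat 1 = (mat 1 :: real^'k^'k)"
    by simp
  define G where "G x z = ennreal (exp (- ((norm z)\<^sup>2 + (norm (x - W *v z))\<^sup>2 / l) / 2))" for x z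
  have meas: "(\<lambda>(x, z). G x z) \<in> borel_measurable (lborel \<Otimes>\<^sub>M lborel)"
  proof -
    have "continuous_on UNIV (\<lambda>p :: (real^'d) \<times> (real^'k). exp (- ((norm (snd p))\<^sup>2 + (norm (fst p - W *v snd p))\<^sup>2 / l) / 2))"
      using l by (intro continuous_intros bounded_linear.continuous_on[OF matrix_vector_mul_bounded_linear]) auto
    then have "(\<lambda>p :: (real^'d) \<times> (real^'k). ennreal (exp (- ((norm (snd p))\<^sup>2 + (norm (fst p - W *v snd p))\<^sup>2 / l) / 2))) \<in> borel_measurable borel"
      by (intro measurable_compose[OF borel_measurable_continuous_onI measurable_ennreal])
    then show ?thesis
      by (simp add: G_def case_prod_beta borel_prod[symmetric] cong: measurable_cong_sets)
  qed
  \<comment> \<open>Factorisation as prior of z times likelihood of x.\<close>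
  have Gx: "G x z = ennreal (exp (- (z \<bullet> (mat 1 *v z)) / 2)) * ennreal (exp (- ((x - W *v z) \<bullet> (mat (1 / l) *v (x - W *v z))) / 2))" for x z
    by (simp add: G_def mat_vector_mult power2_norm_eq_inner add_divide_distrib
        flip: ennreal_mult exp_add)
  \<comment> \<open>Factorisation as marginal of x times posterior of z, by completing the square
    with r = x.\<close>
  have Gz: "G x z = ennreal (exp (- (x \<bullet> (matrix_inv ?K *v x)) / 2))
     * ennreal (exp (- ((z - m) \<bullet> (?M *v (z - m))) / 2))" if "m = transpose W *v (matrix_inv ?K *v x)" for x z m
    unfolding G_def posterior_square_completion[OF l] posterior_precision_quadratic_form that
    by (simp add: add_divide_distrib diff_divide_distrib flip: ennreal_mult exp_add)
  have "(\<integral>\<^sup>+z. \<integral>\<^sup>+x. G x z \<partial>lborel \<partial>lborel)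
     = (\<integral>\<^sup>+z. ennreal (exp (- ((z - 0) \<bullet> (mat 1 *v (z - 0))) / 2)) * ennreal (\<bar>det (mat ?s :: real^'d^'d)\<bar> * cd) \<partial>(lborel :: (real^'k) measure))"
    unfolding Gx cd_def by (subst nn_integral_cmult) (simp_all only: nn_integral_gaussian[OF S] diff_zero, measurable)
  also have "\<dots> = ennreal (?s ^ CARD('d) * cd * ck)"
    using l c by (subst nn_integral_multc, measurable)
      (simp only: nn_integral_gaussian[OF I] ck_def[symmetric], simp add: det_mat ennreal_mult[symmetric] mult_ac)
  finally have 1: "(\<integral>\<^sup>+z. \<integral>\<^sup>+x. G x z \<partial>lborel \<partial>lborel) = ennreal (?s ^ CARD('d) * cd * ck)" .
  have "(\<integral>\<^sup>+x. \<integral>\<^sup>+z. G x z \<partial>lborel \<partial>lborel)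
     = (\<integral>\<^sup>+x. ennreal (exp (- ((x - 0) \<bullet> (matrix_inv ?K *v (x - 0))) / 2)) * ennreal (\<bar>det A\<bar> * ck) \<partial>lborel)"
    unfolding Gz[OF refl] ck_def by (subst nn_integral_cmult) (simp_all only: nn_integral_gaussian[OF A] diff_zero, measurable)
  also have "\<dots> = ennreal (\<bar>det B\<bar> * \<bar>det A\<bar> * cd * ck)"
    using c by (subst nn_integral_multc, measurable)
      (simp only: nn_integral_gaussian[OF B(1)] cd_def[symmetric], simp add: ennreal_mult[symmetric] mult_ac)
  finally have 2: "(\<integral>\<^sup>+x. \<integral>\<^sup>+z. G x z \<partial>lborel \<partial>lborel) = ennreal (\<bar>det B\<bar> * \<bar>det A\<bar> * cd * ck)" .
  have "(\<integral>\<^sup>+z. \<integral>\<^sup>+x. G x z \<partial>lborel \<partial>lborel) = (\<integral>\<^sup>+x. \<integral>\<^sup>+z. G x z \<partial>lborel \<partial>lborel)"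
    using meas by (rule lborel_pair.Fubini')
  \<comment> \<open>Cancelling the constants leaves (sqrt l)^d = |det B| |det A|. Squaring gives l^d
    = det \<open>?K\<close> (det A)^2, and det \<open>?M\<close> (det A)^2 = 1 eliminates A.\<close>
  then have "?s ^ CARD('d) * cd * ck = \<bar>det B\<bar> * \<bar>det A\<bar> * cd * ck"
    unfolding 1 2 using c l by (subst (asm) ennreal_inj) auto
  then have "?s ^ CARD('d) = \<bar>det B\<bar> * \<bar>det A\<bar>"
    using c by simp
  then have "(?s ^ CARD('d))\<^sup>2 = (det B)\<^sup>2 * (det A)\<^sup>2"
    by (simp add: power_mult_distrib)
  moreover have "(?s ^ CARD('d))\<^sup>2 = l ^ CARD('d)"
    using l by (simp only: power_mult[symmetric] mult.commute[of _ "2::nat"]) (simp add: power_mult)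
  ultimately have "l ^ CARD('d) = det ?K * (det A)\<^sup>2"
    by (simp add: B)
  then show ?thesis
    using diagonalize_inverse(3)[OF A] by (simp add: mult.assoc mult.commute[of _ "det ?M"])
qed

text \<open>For standard normal \<open>u\<close>, put \<open>X = (\<bar>u\<bar>\<^sup>2 - \<bar>T u\<bar>\<^sup>2) / 2\<close>: a Gaussian integral gives \<open>E[exp X] = 1 / \<bar>det T\<bar>\<close>,
  and Jensen's inequality bounds it below by \<open>exp (E[X])\<close>.\<close>

lemma ln_det_square_le:
  fixes T :: "real^'n^'n"
  assumes d: "det T \<noteq> 0"
  shows "ln ((det T)\<^sup>2) \<le> (norm T)\<^sup>2 - CARD('n)"
proof -
  obtain R where R: "T ** R = mat 1" "R ** T = mat 1"
    using d by (metis invertible_def invertible_det_nz)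
  define K where "K = sqrt ((2 * pi) ^ CARD('n))"
  have K: "0 < K" by (simp add: K_def)
  define F where "F u = exp (((norm u)\<^sup>2 - (norm (T *v u))\<^sup>2) / 2)" for u
  \<comment> \<open>This is E[X], since |u|^2 has mean \<open>CARD('n)\<close> and |T u|^2 has mean
    |T|^2.\<close>
  define c where "c = (CARD('n) - (norm T)\<^sup>2) / 2"
  have [measurable]: "F \<in> borel_measurable borel"
    unfolding F_def by measurable
  have "transpose R ** (transpose T ** T) ** R = transpose (T ** R) ** (T ** R)"
    by (simp only: matrix_transpose_mul matrix_mul_assoc)
  then have P: "transpose R ** (transpose T ** T) ** R = mat 1"
    by (simp add: R)
  have detR: "\<bar>det R\<bar> = 1 / \<bar>det T\<bar>"
    using arg_cong[OF R(1), of det] d by (simp add: det_mul field_simps flip: abs_mult)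
  \<comment> \<open>The standard density cancels exp (|u|^2 / 2) and leaves a Gaussian with
    precision T^T T, which the inverse \<open>R\<close> of \<open>T\<close> whitens.\<close>
  have eq: "ennreal (mvn_density 0 (mat 1) u) * ennreal (F u)
      = ennreal (1 / K) * ennreal (exp (- ((u - 0) \<bullet> ((transpose T ** T) *v (u - 0))) / 2))" for u
  proof -
    have "mvn_density 0 (mat 1) u = exp (- (u \<bullet> u) / 2) / K"
      by (simp only: mvn_density_std K_def)
    moreover have "F u = exp (u \<bullet> u / 2) * exp (- ((u - 0) \<bullet> ((transpose T ** T) *v (u - 0))) / 2)"
      unfolding F_def diff_zero inner_gram exp_add[symmetric]
      by (simp add: power2_norm_eq_inner[of u] diff_divide_distrib)
    ultimately have "mvn_density 0 (mat 1) u * F u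
        = (exp (- (u \<bullet> u) / 2) * exp (u \<bullet> u / 2)) * ((1 / K) * exp (- ((u - 0) \<bullet> ((transpose T ** T) *v (u - 0))) / 2))"
      by simp
    also have "exp (- (u \<bullet> u) / 2) * exp (u \<bullet> u / 2) = 1"
      by (simp flip: exp_add)
    finally show ?thesis
      using K by (simp add: ennreal_mult[symmetric] F_def)
  qed
  have "(\<integral>\<^sup>+u. ennreal (F u) \<partial>std_gaussian) = (\<integral>\<^sup>+u. ennreal (mvn_density 0 (mat 1) u) * ennreal (F u) \<partial>lborel)"
    unfolding std_gaussian_def by (rule nn_integral_density) measurable
  also have "\<dots> = (\<integral>\<^sup>+u. ennreal (1 / K) * ennreal (exp (- ((u - 0) \<bullet> ((transpose T ** T) *v (u - 0))) / 2)) \<partial>lborel)"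
    by (simp only: eq)
  also have "\<dots> = ennreal (1 / \<bar>det T\<bar>)"
    using K by (subst nn_integral_cmult, measurable)
      (simp only: nn_integral_gaussian[OF P] K_def[symmetric] detR, simp add: ennreal_mult[symmetric])
  finally have F: "has_bochner_integral std_gaussian F (1 / \<bar>det T\<bar>)"
    by (intro has_bochner_integral_nn_integral) (auto simp: F_def[abs_def])
  have "has_bochner_integral std_gaussian
     (\<lambda>u. exp c * ((1 - c) + ((norm (0 + mat 1 *v u))\<^sup>2 - (norm (0 + T *v u))\<^sup>2) / 2))
     (exp c * ((1 - c) + (((norm (0 :: real^'n))\<^sup>2 + (norm (mat 1 :: real^'n^'n))\<^sup>2) - ((norm (0 :: real^'n))\<^sup>2 + (norm T)\<^sup>2)) / 2))"
    by (intro has_bochner_integral_mult_right has_bochner_integral_add has_bochner_integral_divide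
      has_bochner_integral_diff std_gaussian_norm_affine std_gaussian_const)
  then have h: "has_bochner_integral std_gaussian
     (\<lambda>u. exp c * (1 + (((norm u)\<^sup>2 - (norm (T *v u))\<^sup>2) / 2 - c))) (exp c)"
    by (simp add: norm_mat_1 c_def algebra_simps)
  \<comment> \<open>Jensen via the tangent of exp at \<open>c\<close>: the line lies below exp, and
    evaluated at X it has mean \<open>exp c\<close>.\<close>
  have "exp c \<le> 1 / \<bar>det T\<bar>"
  proof -
    have "exp c * (1 + (((norm u)\<^sup>2 - (norm (T *v u))\<^sup>2) / 2 - c)) \<le> F u" for u
    proof -
      have "exp c * (1 + (y - c)) \<le> exp c * exp (y - c)" for y :: real
        by (intro mult_left_mono exp_ge_add_one_self) simp
      then show ?thesis
        unfolding F_def by (simp flip: exp_add)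
    qed
    then have "(\<integral>u. exp c * (1 + (((norm u)\<^sup>2 - (norm (T *v u))\<^sup>2) / 2 - c)) \<partial>std_gaussian) \<le> (\<integral>u. F u \<partial>std_gaussian)"
      using h F by (intro integral_mono) (auto simp: has_bochner_integral_iff)
    then show ?thesis
      using h F by (simp add: has_bochner_integral_iff)
  qed
  then have "c \<le> ln (1 / \<bar>det T\<bar>)"
    using d by (subst ln_ge_iff) auto
  moreover have "ln ((det T)\<^sup>2) = 2 * ln \<bar>det T\<bar>"
    using d by (subst power2_abs[symmetric], subst ln_realpow) auto
  ultimately show ?thesis
    using d by (simp add: ln_div c_def)
qed

section \<open>Divergence and expected log-likelihood\<close>

text \<open>With R = S^-1 the inverse covariance is R^T R, so the form at \<mu> + S u is u . u,
  while the normaliser gains sqrt (det (S S^T)) = |det S|.\<close>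

lemma mvn_density_affine:
  fixes S :: "real^'n^'n"
  assumes d: "det S \<noteq> 0"
  shows "mvn_density \<mu> (S ** transpose S) (\<mu> + S *v u) = mvn_density 0 (mat 1) u / \<bar>det S\<bar>"
proof -
  obtain R where R: "S ** R = mat 1" "R ** S = mat 1"
    using d by (metis invertible_def invertible_det_nz)
  have "transpose S ** transpose R = mat 1"
    using R(2) by (metis matrix_transpose_mul transpose_mat)
  then have "(S ** transpose S) ** (transpose R ** R) = mat 1"
    by (metis R(1) matrix_mul_assoc matrix_mul_lid)
  then have inv: "matrix_inv (S ** transpose S) = transpose R ** R"
    by (rule matrix_inv_eqI)
  have "transpose S ** (transpose R ** R) ** S = (transpose S ** transpose R) ** (R ** S)"
    by (simp only: matrix_mul_assoc)
  then have q: "(S *v u) \<bullet> (matrix_inv (S ** transpose S) *v (S *v u)) = u \<bullet> u"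
    unfolding inner_congruence inv by (simp add: R \<open>transpose S ** transpose R = mat 1\<close>)
  have "sqrt ((2 * pi) ^ CARD('n) * det (S ** transpose S)) = sqrt ((2 * pi) ^ CARD('n)) * \<bar>det S\<bar>"
    by (simp only: det_mul det_transpose real_sqrt_mult real_sqrt_mult_self abs_mult_self_eq power2_eq_square[symmetric] real_sqrt_abs)
  then show ?thesis
    unfolding mvn_density_std unfolding mvn_density_def add_diff_cancel_left' q by simp
qed

lemma mvn_eq_density:
  fixes S :: "real^'n^'n"
  assumes "det S \<noteq> 0"
  shows "mvn \<mu> (S ** transpose S) = density lborel (\<lambda>y. ennreal (mvn_density \<mu> (S ** transpose S) y))"
  using assms by (simp add: mvn_def invertible_det_nz det_mul)

text \<open>In the change of variables y = \<mu> + S u the Jacobian |det S| cancels the factor 1 /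
  |det S| of the density. Encoder expectations thereby become expectations over a standard normal
  u.\<close>

lemma mvn_eq_distr:
  fixes S :: "real^'n^'n"
  assumes d: "det S \<noteq> 0"
  shows "mvn \<mu> (S ** transpose S) = distr std_gaussian borel (\<lambda>u. \<mu> + S *v u)"
proof (rule measure_eqI)
  fix X assume "X \<in> sets (mvn \<mu> (S ** transpose S))"
  then have [measurable]: "X \<in> sets borel"
    by (simp add: mvn_eq_density[OF d])
  let ?D = "mvn_density \<mu> (S ** transpose S)"
  have "emeasure (mvn \<mu> (S ** transpose S)) X = (\<integral>\<^sup>+y. ennreal (?D y) * indicator X y \<partial>lborel)"
    by (simp add: mvn_eq_density[OF d] emeasure_density)
  also have "\<dots> = \<bar>det S\<bar> * (\<integral>\<^sup>+u. ennreal (?D (\<mu> + S *v u)) * indicator X (\<mu> + S *v u) \<partial>lborel)"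
    by (rule nn_integral_lborel_matrix_affine[OF d]) measurable
  also have "\<dots> = (\<integral>\<^sup>+u. ennreal \<bar>det S\<bar> * (ennreal (?D (\<mu> + S *v u)) * indicator X (\<mu> + S *v u)) \<partial>lborel)"
    by (rule nn_integral_cmult[symmetric]) measurable
  also have "\<dots> = (\<integral>\<^sup>+u. ennreal (mvn_density 0 (mat 1) u) * indicator X (\<mu> + S *v u) \<partial>lborel)"
    using d by (simp add: mvn_density_affine mult.assoc[symmetric] ennreal_mult[symmetric])
  also have "\<dots> = (\<integral>\<^sup>+u. ennreal (mvn_density 0 (mat 1) u) * indicator ((\<lambda>u. \<mu> + S *v u) -` X) u \<partial>lborel)"
    by (simp add: indicator_def)
  also have "\<dots> = emeasure std_gaussian ((\<lambda>u. \<mu> + S *v u) -` X)"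
    unfolding std_gaussian_def
    by (subst emeasure_density) (auto intro!: measurable_sets_borel[where M=borel])
  also have "\<dots> = emeasure (distr std_gaussian borel (\<lambda>u. \<mu> + S *v u)) X"
    by (simp add: emeasure_distr)
  finally show "emeasure (mvn \<mu> (S ** transpose S)) X = emeasure (distr std_gaussian borel (\<lambda>u. \<mu> + S *v u)) X" .
qed (simp add: mvn_eq_density[OF d])

text \<open>At \<mu> + S u the log ratio of the densities is (|\<mu> + S u|^2 - |u|^2) / 2 - ln |det
  S|, whose mean is known. Integrability comes with the value, so the finite branch of
  \<open>KL\<close> applies.\<close>

lemma KL_mvn_std_nonsingular:
  fixes S :: "real^'n^'n"
  assumes d: "det S \<noteq> 0"
  shows "KL (mvn \<mu> (S ** transpose S)) (mvn 0 (mat 1))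
    = ereal (((norm S)\<^sup>2 + (norm \<mu>)\<^sup>2 - CARD('n) - ln ((det S)\<^sup>2)) / 2)"
proof -
  interpret g: prob_space "std_gaussian :: (real^'n) measure" by (rule prob_space_std_gaussian)
  let ?q = "mvn \<mu> (S ** transpose S)" and ?p = "std_gaussian :: (real^'n) measure"
  let ?D = "mvn_density \<mu> (S ** transpose S)" and ?\<phi> = "mvn_density 0 (mat 1) :: real^'n \<Rightarrow> real"
  define \<rho> where "\<rho> z = ?D z / ?\<phi> z" for z
  have [measurable]: "\<rho> \<in> borel_measurable borel"
    unfolding \<rho>_def by measurable
  have \<phi>_pos: "0 < ?\<phi> u" for u
    by (simp add: mvn_density_std)
  have \<rho>_nonneg: "0 \<le> \<rho> z" for z
    using \<phi>_pos[of z] by (simp add: \<rho>_def det_mul)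
  have q: "?q = density ?p (\<lambda>z. ennreal (\<rho> z))"
  proof -
    have "ennreal (?\<phi> z) * ennreal (\<rho> z) = ennreal (?D z)" for z
      using \<phi>_pos[of z] \<rho>_nonneg[of z] by (simp add: ennreal_mult[symmetric] \<rho>_def)
    then show ?thesis
      unfolding mvn_eq_density[OF d] std_gaussian_def by (subst density_density_eq) simp_all
  qed
  have ac: "absolutely_continuous ?p ?q"
    unfolding q by (rule absolutely_continuousI_density) measurable
  \<comment> \<open>\<open>entropy_density\<close> uses the Radon-Nikodym derivative, which is
    determined only almost everywhere; here it is identified with \<open>\<rho>\<close>.\<close>
  have "AE z in ?p. ennreal (\<rho> z) = RN_deriv ?p ?q z"
    by (rule g.RN_deriv_unique[OF _ q[symmetric]]) measurable
  then have RN: "AE z in ?q. entropy_density (exp 1) ?p ?q z = ln (\<rho> z)"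
    unfolding q by (subst AE_density) (auto elim!: eventually_mono simp: entropy_density_def log_def \<rho>_nonneg
       dest: sym)
  \<comment> \<open>The trivial \<open>0 + mat 1 *v u\<close> brings |u|^2 into the form that
    \<open>std_gaussian_norm_affine\<close> expects.\<close>
  let ?h = "\<lambda>u. ((norm (\<mu> + S *v u))\<^sup>2 - (norm (0 + mat 1 *v u))\<^sup>2) / 2 - ln \<bar>det S\<bar>"
  have ln\<rho>: "ln (\<rho> (\<mu> + S *v u)) = ?h u" for u
  proof -
    let ?K = "sqrt ((2 * pi) ^ CARD('n))"
    have K: "0 < ?K" by simp
    have "\<rho> (\<mu> + S *v u) = exp (- (u \<bullet> u) / 2 - - ((\<mu> + S *v u) \<bullet> (\<mu> + S *v u)) / 2) / \<bar>det S\<bar>"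
      unfolding \<rho>_def mvn_density_affine[OF d] unfolding mvn_density_std exp_diff using K by simp
    also have "ln \<dots> = - (u \<bullet> u) / 2 + ((\<mu> + S *v u) \<bullet> (\<mu> + S *v u)) / 2 - ln \<bar>det S\<bar>"
      using d by (subst ln_div) simp_all
    finally show ?thesis
      by (simp add: power2_norm_eq_inner diff_divide_distrib)
  qed
  have "has_bochner_integral ?p ?h
    ((((norm \<mu>)\<^sup>2 + (norm S)\<^sup>2) - ((norm (0 :: real^'n))\<^sup>2 + (norm (mat 1 :: real^'n^'n))\<^sup>2)) / 2 - ln \<bar>det S\<bar>)"
    by (intro has_bochner_integral_divide has_bochner_integral_diff std_gaussian_norm_affine std_gaussian_const)
  moreover have "ln ((det S)\<^sup>2) = 2 * ln \<bar>det S\<bar>"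
    using d by (subst power2_abs[symmetric], subst ln_realpow) auto
  ultimately have "has_bochner_integral ?p (\<lambda>u. ln (\<rho> (\<mu> + S *v u)))
      (((norm S)\<^sup>2 + (norm \<mu>)\<^sup>2 - CARD('n) - ln ((det S)\<^sup>2)) / 2)"
    by (simp add: ln\<rho> norm_mat_1 diff_divide_distrib add_divide_distrib algebra_simps)
  then have "has_bochner_integral ?q (\<lambda>z. ln (\<rho> z)) (((norm S)\<^sup>2 + (norm \<mu>)\<^sup>2 - CARD('n) - ln ((det S)\<^sup>2)) / 2)"
    unfolding mvn_eq_distr[OF d] by (intro has_bochner_integral_distr) measurable
  then have "has_bochner_integral ?q (entropy_density (exp 1) ?p ?q) (((norm S)\<^sup>2 + (norm \<mu>)\<^sup>2 - CARD('n) - ln ((det S)\<^sup>2)) / 2)"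
    by (subst has_bochner_integral_cong_AE[OF _ _ RN]) (simp_all add: mvn_eq_density[OF d] std_gaussian_def)
  then show ?thesis
    using ac by (simp add: KL_def KL_divergence_def mvn_std has_bochner_integral_iff)
qed

text \<open>A singular covariance confines the law to an affine hyperplane of Lebesgue measure zero,
  so absolute continuity fails.\<close>

lemma KL_mvn_std_singular:
  fixes S :: "real^'n^'n"
  assumes d: "det S = 0"
  shows "KL (mvn \<mu> (S ** transpose S)) (mvn 0 (mat 1)) = \<infinity>"
proof -
  \<comment> \<open>This is the factor selected inside \<open>mvn\<close>. It may differ from
    \<open>S\<close>, but (det A)^2 = (det S)^2, so it is singular too.\<close>
  define A where "A = (SOME A :: real^'n^'n. A ** transpose A = S ** transpose S)"
  have A: "A ** transpose A = S ** transpose S"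
    unfolding A_def by (rule someI[of _ S]) simp
  have "det A = 0"
    using arg_cong[OF A, of det] d by (simp add: det_mul)
  then have "\<not> inj ((*v) (transpose A))"
    using det_nz_iff_inj_gen[of "(*v) (transpose A)"] by (simp add: matrix_vector_mul_linear del: transpose_matrix_vector)
  then obtain v where v: "v \<noteq> 0" "transpose A *v v = 0"
    by (metis linear_injective_0 matrix_vector_mul_linear)
  \<comment> \<open>a hyperplane carrying the singular Gaussian, null for the prior\<close>
  define N where "N = {z. v \<bullet> z = v \<bullet> \<mu>}"
  have N: "N \<in> sets borel"
    unfolding N_def by (intro borel_closed closed_hyperplane)
  have "negligible N"
    unfolding N_def using v by (intro negligible_hyperplane) simp
  then have "N \<in> null_sets lborel"
    using N by (simp add: negligible_iff_null_sets null_sets_completion_iff)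
  then have "N \<in> null_sets (std_gaussian :: (real^'n) measure)"
    using absolutely_continuousI_density[of "\<lambda>u :: real^'n. ennreal (mvn_density 0 (mat 1) u)" lborel]
    by (auto simp: std_gaussian_def absolutely_continuous_def)
  moreover have "N \<notin> null_sets (mvn \<mu> (S ** transpose S))"
  proof -
    have "(A *v u) \<bullet> v = 0" for u
      by (simp only: matrix_vector_inner v inner_zero_right)
    then have "\<mu> + A *v u \<in> N" for u
      by (simp add: N_def inner_add_right inner_commute[of v "A *v u"])
    then have vim: "(\<lambda>u. \<mu> + A *v u) -` N = UNIV" by auto
    have "\<not> invertible (S ** transpose S)"
      using d by (simp add: invertible_det_nz det_mul)
    then have "mvn \<mu> (S ** transpose S) = distr std_gaussian borel (\<lambda>u. \<mu> + A *v u)"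
      unfolding mvn_def A_def std_gaussian_def by simp
    then have "emeasure (mvn \<mu> (S ** transpose S)) N = emeasure (std_gaussian :: (real^'n) measure) UNIV"
      using N vim by (simp add: emeasure_distr)
    also have "\<dots> = 1"
      using prob_space.emeasure_space_1[OF prob_space_std_gaussian] by simp
    finally show ?thesis
      by auto
  qed
  ultimately show ?thesis
    by (auto simp: KL_def mvn_std absolutely_continuous_def)
qed

text \<open>The log-density is a constant minus |y - b - W z|^2 / (2 l); for z = \<mu> + S u the
  residual is affine in u with matrix -(W S).\<close>

lemma integral_log_likelihood_mvn:
  fixes S :: "real^'k^'k" and W :: "real^'k^'d"
  assumes d: "det S \<noteq> 0" and l: "l > 0"
  shows "(\<integral>z. ln (mvn_density (W *v z + b) (mat l) y) \<partial>mvn \<mu> (S ** transpose S))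
    = - (((norm (y - b - W *v \<mu>))\<^sup>2 + (norm (W ** S))\<^sup>2) / l + CARD('d) * ln (2 * pi * l)) / 2"
proof -
  have inv: "matrix_inv (mat l :: real^'d^'d) = mat (1 / l)"
    using l by (intro matrix_inv_eqI) (simp add: mat_mult_mat)
  have dens: "ln (mvn_density (W *v z + b) (mat l) y) = - ((norm (y - b - W *v z))\<^sup>2 / l + CARD('d) * ln (2 * pi * l)) / 2" for z
  proof -
    have nz: "sqrt ((2 * pi * l) ^ CARD('d)) \<noteq> 0"
      using l by simp
    have e: "y - (W *v z + b) = y - b - W *v z"
      by (simp add: algebra_simps)
    have pos: "0 < 2 * pi * l" using l by simp
    have "mvn_density (W *v z + b) (mat l) y
        = exp (- ((norm (y - b - W *v z))\<^sup>2 / l) / 2) / sqrt ((2 * pi * l) ^ CARD('d))"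
      unfolding mvn_density_def inv det_mat e
      by (simp only: mat_vector_mult inner_scaleR_right power2_norm_eq_inner power_mult_distrib) simp
    also have "ln \<dots> = - ((norm (y - b - W *v z))\<^sup>2 / l) / 2 - ln (sqrt ((2 * pi * l) ^ CARD('d)))"
      by (simp only: ln_div exp_not_eq_zero nz ln_exp simp_thms if_True not_False_eq_True)
    also have "ln (sqrt ((2 * pi * l) ^ CARD('d))) = CARD('d) * ln (2 * pi * l) / 2"
      by (simp only: ln_sqrt[OF zero_le_power[OF less_imp_le[OF pos]]] ln_realpow)
    finally show ?thesis by (simp add: add_divide_distrib)
  qed
  have minus: "(norm (W ** S))\<^sup>2 = (norm (- (W ** S)))\<^sup>2" by simp
  have neg: "y - b - W *v (\<mu> + S *v u) = (y - b - W *v \<mu>) + (- (W ** S)) *v u" for u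
    by (simp add: matrix_vector_right_distrib matrix_vector_mul_assoc)
      (simp add: matrix_vector_mult_def vec_eq_iff sum_negf)
  have "has_bochner_integral std_gaussian
     (\<lambda>u. - ((norm ((y - b - W *v \<mu>) + (- (W ** S)) *v u))\<^sup>2 / l + CARD('d) * ln (2 * pi * l)) / 2)
     (- (((norm (y - b - W *v \<mu>))\<^sup>2 + (norm (- (W ** S)))\<^sup>2) / l + CARD('d) * ln (2 * pi * l)) / 2)"
    by (intro has_bochner_integral_divide has_bochner_integral_minus has_bochner_integral_add std_gaussian_norm_affine std_gaussian_const)
  then have "has_bochner_integral (distr std_gaussian borel (\<lambda>u. \<mu> + S *v u))
     (\<lambda>z. - ((norm (y - b - W *v z))\<^sup>2 / l + CARD('d) * ln (2 * pi * l)) / 2)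
     (- (((norm (y - b - W *v \<mu>))\<^sup>2 + (norm (W ** S))\<^sup>2) / l + CARD('d) * ln (2 * pi * l)) / 2)"
    unfolding minus neg[symmetric] by (intro has_bochner_integral_distr) measurable
  then show ?thesis
    unfolding mvn_eq_distr[OF d] dens by (rule has_bochner_integral_integral_eq)
qed

section \<open>Minimising over the encoder\<close>

lemma norm_matrix_columns: "(norm (X :: real^'n^'m))\<^sup>2 = (\<Sum>j\<in>UNIV. (norm (X *v axis j 1))\<^sup>2)"
proof -
  have "(norm X)\<^sup>2 = (\<Sum>j\<in>UNIV. \<Sum>i\<in>UNIV. (X $ i $ j)\<^sup>2)"
    unfolding norm_matrix_sq by (rule sum.swap)
  then show ?thesis
    unfolding power2_norm_eq_inner by (simp add: inner_vec_def matrix_vector_mult_basis column_def power2_eq_square)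
qed

lemma norm_matrix_trace: "(norm (X :: real^'n^'m))\<^sup>2 = (\<Sum>i\<in>UNIV. (X ** transpose X) $ i $ i)"
  unfolding norm_matrix_sq by (simp add: matrix_matrix_mult_def transpose_def power2_eq_square)

text \<open>For nonsingular \<open>S\<close> and \<Sigma> = S S^T this is tr \<Sigma> + tr (W
  \<Sigma> W^T) / l - ln det \<Sigma>. At \<open>det S = 0\<close> the default value of
  \<open>ln 0\<close> has no meaning for the cost, so comparisons are restricted to nonsingular
  factors.\<close>

definition cov_cost :: "real^'k^'d \<Rightarrow> real \<Rightarrow> real^'k^'k \<Rightarrow> real" where
  "cov_cost W l S = (norm S)\<^sup>2 + (norm (W ** S))\<^sup>2 / l - ln ((det S)\<^sup>2)"

text \<open>Column by column, \<open>M\<close> is the matrix of the form |v|^2 + |W v|^2 / l, which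
  at A v equals |v|^2. The term ln (det M) arises from (det A)^2 = 1 / det M.\<close>

lemma cov_cost_whiten:
  fixes W :: "real^'k^'d" and A T :: "real^'k^'k" and l :: real
  defines "M \<equiv> mat 1 + (1 / l) *\<^sub>R (transpose W ** W)"
  assumes A: "transpose A ** M ** A = mat 1" and T: "det T \<noteq> 0"
  shows "cov_cost W l (A ** T) = (norm T)\<^sup>2 - ln ((det T)\<^sup>2) + ln (det M)"
proof -
  have "(norm (A ** T))\<^sup>2 + (norm (W ** (A ** T)))\<^sup>2 / l
    = (\<Sum>j\<in>UNIV. (norm (A *v (T *v axis j 1)))\<^sup>2 + (norm (W *v (A *v (T *v axis j 1))))\<^sup>2 / l)"
    unfolding norm_matrix_columns matrix_vector_mul_assoc[symmetric] by (simp add: sum.distrib sum_divide_distrib)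
  also have "\<dots> = (norm T)\<^sup>2"
  proof -
    have "(norm (A *v v))\<^sup>2 + (norm (W *v (A *v v)))\<^sup>2 / l = (norm v)\<^sup>2" for v
      unfolding posterior_precision_quadratic_form[symmetric] M_def[symmetric] inner_congruence A
      by (simp add: power2_norm_eq_inner)
    then show ?thesis
      by (simp only: norm_matrix_columns[of T])
  qed
  finally have n: "(norm (A ** T))\<^sup>2 + (norm (W ** (A ** T)))\<^sup>2 / l = (norm T)\<^sup>2" .
  have M: "det M * (det A)\<^sup>2 = 1"
    by (rule diagonalize_inverse(3)[OF A])
  then have pos: "0 < (det A)\<^sup>2" "0 < (det T)\<^sup>2"
    using T by auto
  have "det M = 1 / (det A)\<^sup>2"
    using M pos by (simp add: field_simps)
  then have "ln (det M) = - ln ((det A)\<^sup>2)"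
    by (simp only: ln_div) (use pos in simp)
  moreover have "ln ((det (A ** T))\<^sup>2) = ln ((det A)\<^sup>2) + ln ((det T)\<^sup>2)"
    unfolding det_mul power_mult_distrib using pos by (intro ln_mult_pos)
  ultimately show ?thesis
    unfolding cov_cost_def n by simp
qed

text \<open>The whitening factor A is itself the minimiser, the case T = I, and its covariance A A^T
  is M^-1. Any nonsingular \<open>S'\<close> equals A T with T = A^-1 S', to which
  \<open>ln_det_square_le\<close> applies.\<close>

lemma cov_cost_min:
  fixes W :: "real^'k^'d"
  assumes l: "l > 0"
  obtains S where "S ** transpose S = opt_cov W l" "det S \<noteq> 0"
    "cov_cost W l S = CARD('k) + ln (det (mat 1 + (1 / l) *\<^sub>R (transpose W ** W)))"
    "\<And>S'. det S' \<noteq> 0 \<Longrightarrow> cov_cost W l S \<le> cov_cost W l S'"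
proof -
  let ?M = "mat 1 + (1 / l) *\<^sub>R (transpose W ** W)"
  obtain A :: "real^'k^'k" where A: "transpose A ** ?M ** A = mat 1"
    using posdef_diagonalize[OF posdef_scalar_plus_gram[of 1 "1 / l" W]] l by auto
  have d: "det A \<noteq> 0"
    using diagonalize_inverse(3)[OF A] by auto
  then obtain R where R: "A ** R = mat 1"
    by (metis invertible_def invertible_det_nz)
  have v: "cov_cost W l A = CARD('k) + ln (det ?M)"
    using cov_cost_whiten[OF A, of "mat 1"] by (simp add: norm_mat_1)
  show ?thesis
  proof (rule that[OF _ d v])
    show "A ** transpose A = opt_cov W l"
      using diagonalize_inverse(2)[OF A] by (simp add: opt_cov_def)
    fix S' :: "real^'k^'k" assume "det S' \<noteq> 0"
    have S': "S' = A ** (R ** S')"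
      by (simp add: matrix_mul_assoc R)
    with \<open>det S' \<noteq> 0\<close> have T: "det (R ** S') \<noteq> 0"
      by (metis det_mul mult_zero_right)
    show "cov_cost W l A \<le> cov_cost W l S'"
      by (subst S') (use cov_cost_whiten[OF A T] ln_det_square_le[OF T] v in linarith)
  qed
qed

text \<open>Only S S^T is assumed diagonal, not \<open>S\<close>, so every term is expressed through
  the diagonal of S S^T. Its entries are sums of squares with nonzero product (det S)^2, hence
  positive.\<close>

lemma cov_cost_diagonal:
  fixes W :: "real^'k^'d" and S :: "real^'k^'k"
  defines "\<sigma> \<equiv> \<lambda>j. (S ** transpose S) $ j $ j"
  assumes S: "diagonal (S ** transpose S)" and d: "det S \<noteq> 0"
  shows "cov_cost W l S = (\<Sum>j\<in>UNIV. \<sigma> j * (1 + (norm (column j W))\<^sup>2 / l) - ln (\<sigma> j))"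
    and "\<And>j. 0 < \<sigma> j"
proof -
  let ?C = "S ** transpose S"
  have C: "?C $ i $ j = (if i = j then \<sigma> j else 0)" for i j
    using S by (simp add: diagonal_def \<sigma>_def)
  have det: "(det S)\<^sup>2 = (\<Prod>j\<in>UNIV. \<sigma> j)"
  proof -
    have "(det S)\<^sup>2 = det ?C" by (simp add: det_mul power2_eq_square)
    also have "\<dots> = (\<Prod>j\<in>UNIV. \<sigma> j)" by (subst det_diagonal) (simp_all add: C)
    finally show ?thesis .
  qed
  have nonneg: "0 \<le> \<sigma> j" for j
    unfolding \<sigma>_def by (simp add: matrix_matrix_mult_def transpose_def sum_nonneg)
  show pos: "0 < \<sigma> j" for j
  proof -
    have "(\<Prod>j\<in>UNIV. \<sigma> j) \<noteq> 0"
      unfolding det[symmetric] using d by simp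
    then have "\<sigma> j \<noteq> 0" by simp
    then show ?thesis using nonneg[of j] by linarith
  qed
  have "(norm (W ** S))\<^sup>2 = (\<Sum>a\<in>UNIV. (W ** ?C ** transpose W) $ a $ a)"
    by (simp add: norm_matrix_trace matrix_transpose_mul matrix_mul_assoc)
  also have "\<dots> = (\<Sum>a\<in>UNIV. \<Sum>j\<in>UNIV. \<sigma> j * (W $ a $ j)\<^sup>2)"
  proof -
    have "(W ** ?C) $ a $ j = W $ a $ j * \<sigma> j" for a j
      by (simp add: matrix_matrix_mult_def[of W] C if_distrib cong: if_cong)
    moreover have "(X ** transpose W) $ a $ a = (\<Sum>j\<in>UNIV. X $ a $ j * W $ a $ j)" for X :: "real^'k^'d" and a
      by (simp add: matrix_matrix_mult_def transpose_def)
    ultimately show ?thesis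
      by (simp add: power2_eq_square mult_ac)
  qed
  also have "\<dots> = (\<Sum>j\<in>UNIV. \<sigma> j * (norm (column j W))\<^sup>2)"
    unfolding power2_norm_eq_inner
    by (subst sum.swap) (simp add: inner_vec_def column_def power2_eq_square sum_distrib_left)
  finally have WS: "(norm (W ** S))\<^sup>2 = (\<Sum>j\<in>UNIV. \<sigma> j * (norm (column j W))\<^sup>2)" .
  have "(norm S)\<^sup>2 = (\<Sum>j\<in>UNIV. \<sigma> j)"
    by (simp add: norm_matrix_trace \<sigma>_def)
  moreover have "ln ((det S)\<^sup>2) = (\<Sum>j\<in>UNIV. ln (\<sigma> j))"
    unfolding det by (rule ln_prod) (simp_all add: less_imp_neq[OF pos, THEN not_sym])
  ultimately show "cov_cost W l S = (\<Sum>j\<in>UNIV. \<sigma> j * (1 + (norm (column j W))\<^sup>2 / l) - ln (\<sigma> j))"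
    by (simp add: cov_cost_def WS sum.distrib sum_subtractf sum_divide_distrib distrib_left)
qed

text \<open>With a = 1 + |w_j|^2 / l, the j-th term a t - ln t is least at t = 1 / a, because ln (a
  t) \<le> a t - 1.\<close>

lemma cov_cost_min_diagonal:
  fixes W :: "real^'k^'d"
  assumes l: "l > 0"
  obtains S where "diagonal S" "S ** transpose S = opt_cov_sep W l" "det S \<noteq> 0"
    "cov_cost W l S = CARD('k) + (\<Sum>j\<in>UNIV. ln (l + (norm (column j W))\<^sup>2)) - CARD('k) * ln l"
    "\<And>S'. diagonal (S' ** transpose S') \<Longrightarrow> det S' \<noteq> 0 \<Longrightarrow> cov_cost W l S \<le> cov_cost W l S'"
proof -
  let ?c = "\<lambda>j. l + (norm (column j W))\<^sup>2"
  \<comment> \<open>The entrywise square root of the optimal covariance is diagonal, as membership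
    in a diagonal encoder class requires.\<close>
  define S :: "real^'k^'k" where "S = (\<chi> i j. if i = j then sqrt (l / ?c j) else 0)"
  have c: "0 < ?c j" for j
    using l by (simp add: add_pos_nonneg)
  have m: "1 + (norm (column j W))\<^sup>2 / l = ?c j / l" for j
    using l by (simp add: field_simps)
  have diag: "diagonal S" by (simp add: diagonal_def S_def)
  have "(S ** transpose S) $ i $ j = (if i = j then l / ?c j else 0)" for i j
  proof -
    have "S $ i $ k * transpose S $ k $ j = (if k = i then if i = j then l / ?c j else 0 else 0)" for k
      using l c[of j] by (auto simp: S_def transpose_def)
    then show ?thesis
      by (simp add: matrix_matrix_mult_def)
  qed
  then have SS: "S ** transpose S = opt_cov_sep W l"
    by (simp add: vec_eq_iff opt_cov_sep_def)
  have dS: "det S \<noteq> 0"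
    using l c by (subst det_diagonal) (auto simp: S_def less_imp_neq[THEN not_sym])
  have diagS: "diagonal (S ** transpose S)"
    by (simp add: SS opt_cov_sep_def diagonal_def)
  have "cov_cost W l S = (\<Sum>j\<in>UNIV. 1 + (ln (?c j) - ln l))"
    unfolding cov_cost_diagonal(1)[OF diagS dS] m SS
  proof (rule sum.cong[OF refl])
    fix j :: 'k
    have "ln (l / ?c j) = ln l - ln (?c j)" using l c[of j] by (simp add: ln_div)
    then show "opt_cov_sep W l $ j $ j * (?c j / l) - ln (opt_cov_sep W l $ j $ j) = 1 + (ln (?c j) - ln l)"
      using l c[of j] by (simp add: opt_cov_sep_def)
  qed
  then have v: "cov_cost W l S = CARD('k) + (\<Sum>j\<in>UNIV. ln (?c j)) - CARD('k) * ln l"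
    by (simp add: sum.distrib sum_subtractf)
  show ?thesis
  proof (rule that[OF diag SS dS v])
    fix S' :: "real^'k^'k" assume S': "diagonal (S' ** transpose S')" "det S' \<noteq> 0"
    let ?s = "\<lambda>j. (S' ** transpose S') $ j $ j"
    have "(\<Sum>j\<in>UNIV. 1 + (ln (?c j) - ln l)) \<le> (\<Sum>j\<in>UNIV. ?s j * (?c j / l) - ln (?s j))"
    proof (rule sum_mono)
      fix j :: 'k
      have s: "0 < ?s j" by (rule cov_cost_diagonal(2)[OF S'])
      have "ln (?s j * (?c j / l)) \<le> ?s j * (?c j / l) - 1"
        using s c[of j] l by (intro ln_le_minus_one) simp
      moreover have "ln (?s j * (?c j / l)) = ln (?s j) + (ln (?c j) - ln l)"
        using s c[of j] l by (simp only: ln_mult_pos ln_divide_pos divide_pos_pos)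
      ultimately show "1 + (ln (?c j) - ln l) \<le> ?s j * (?c j / l) - ln (?s j)"
        by linarith
    qed
    then show "cov_cost W l S \<le> cov_cost W l S'"
      unfolding cov_cost_diagonal(1)[OF S'] m \<open>cov_cost W l S = (\<Sum>j\<in>UNIV. 1 + (ln (?c j) - ln l))\<close> .
  qed
qed

section \<open>The cost of one sample and its sum over the data\<close>

definition mean_cost :: "real^'d \<Rightarrow> real^'k^'d \<Rightarrow> real^'d \<Rightarrow> real \<Rightarrow> real^'k \<Rightarrow> real" where
  "mean_cost y W b l \<mu> = (norm \<mu>)\<^sup>2 + (norm (y - b - W *v \<mu>))\<^sup>2 / l"

text \<open>Completing the square with r = y - b leaves a nonnegative excess over
  \<open>Omega\<close> that vanishes at \<open>opt_mean\<close>.\<close>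

lemma mean_cost_opt:
  assumes "l > 0"
  shows "mean_cost y W b l (opt_mean W b l y) = Omega y W b (mat l)"
    and "Omega y W b (mat l) \<le> mean_cost y W b l \<mu>"
  using assms unfolding mean_cost_def posterior_square_completion[OF assms] Omega_def opt_mean_def
  by simp_all

definition sample_cost :: "real^'d \<Rightarrow> real^'k^'d \<Rightarrow> real^'d \<Rightarrow> real \<Rightarrow> real^'k \<Rightarrow> real^'k^'k \<Rightarrow> ereal" where
  "sample_cost y W b l \<mu> S = KL (mvn \<mu> (S ** transpose S)) (mvn 0 (mat 1))
    - ereal (\<integral>z. ln (mvn_density (W *v z + b) (mat l) y) \<partial>mvn \<mu> (S ** transpose S))"

lemma sample_cost_nonsingular:
  fixes W :: "real^'k^'d"
  assumes "l > 0" "det S \<noteq> 0"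
  shows "sample_cost y W b l \<mu> S
    = ereal ((cov_cost W l S + mean_cost y W b l \<mu> + CARD('d) * ln (2 * pi * l) - CARD('k)) / 2)"
  unfolding sample_cost_def KL_mvn_std_nonsingular[OF assms(2)] integral_log_likelihood_mvn[OF assms(2,1)]
    cov_cost_def mean_cost_def
  by (simp add: add_divide_distrib diff_divide_distrib)

lemma sample_cost_singular: "det S = 0 \<Longrightarrow> sample_cost y W b l \<mu> S = \<infinity>"
  by (simp add: sample_cost_def KL_mvn_std_singular)

lemma affine_vae_eq_sum:
  "affine_vae n x f g W b l \<phi> = (\<Sum>i<n. sample_cost (x i) W b l (f (x i) \<phi>) (g (x i) \<phi>))"
  by (simp add: affine_vae_def vae_objective_def sample_cost_def encoder_cov_def)

text \<open>\<open>P\<close> is the constraint on the covariance factor, so one argument serves full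
  and diagonal covariances. Mean and covariance parts are bounded separately for each sample, and
  singular factors cost \<infinity>. A single parameter attains all bounds, since the same factor is
  optimal for every sample.\<close>

lemma affine_vae_optimum:
  fixes f :: "real^'d \<Rightarrow> 'p \<Rightarrow> real^'k" and W :: "real^'k^'d"
  assumes l: "l > 0" and S: "det S \<noteq> 0"
    and min: "\<And>S'. P S' \<Longrightarrow> det S' \<noteq> 0 \<Longrightarrow> cov_cost W l S \<le> cov_cost W l S'"
    and \<phi>: "\<And>y. f y \<phi> = opt_mean W b l y" "\<And>y. g y \<phi> = S"
  shows "2 * affine_vae n x f g W b l \<phi>
      = ereal ((\<Sum>i<n. Omega (x i) W b (mat l)) + real n * (cov_cost W l S + CARD('d) * ln (2 * pi * l) - CARD('k)))"
    and "(\<And>y. P (g y \<phi>')) \<Longrightarrow> affine_vae n x f g W b l \<phi> \<le> affine_vae n x f g W b l \<phi>'"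
proof -
  let ?o = "\<lambda>y. (cov_cost W l S + Omega y W b (mat l) + CARD('d) * ln (2 * pi * l) - CARD('k)) / 2"
  have opt: "affine_vae n x f g W b l \<phi> = (\<Sum>i<n. ereal (?o (x i)))"
    by (simp add: affine_vae_eq_sum \<phi> sample_cost_nonsingular[OF l S] mean_cost_opt[OF l])
  show "2 * affine_vae n x f g W b l \<phi>
      = ereal ((\<Sum>i<n. Omega (x i) W b (mat l)) + real n * (cov_cost W l S + CARD('d) * ln (2 * pi * l) - CARD('k)))"
  proof -
    have "2 * (\<Sum>i<n. ?o (x i)) = (\<Sum>i<n. cov_cost W l S + Omega (x i) W b (mat l) + CARD('d) * ln (2 * pi * l) - CARD('k))"
      by (simp only: sum_distrib_left mult_2 field_sum_of_halves)
    also have "\<dots> = (\<Sum>i<n. Omega (x i) W b (mat l)) + real n * (cov_cost W l S + CARD('d) * ln (2 * pi * l) - CARD('k))"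
      by (simp add: sum.distrib sum_subtractf algebra_simps)
    finally have "ereal 2 * ereal (\<Sum>i<n. ?o (x i)) = ereal ((\<Sum>i<n. Omega (x i) W b (mat l))
        + real n * (cov_cost W l S + CARD('d) * ln (2 * pi * l) - CARD('k)))"
      by (simp only: times_ereal.simps)
    then show ?thesis
      unfolding opt sum_ereal numeral_eq_ereal .
  qed
  assume P: "\<And>y. P (g y \<phi>')"
  have "ereal (?o y) \<le> sample_cost y W b l (f y \<phi>') (g y \<phi>')" for y
  proof (cases "det (g y \<phi>') = 0")
    case False
    then show ?thesis
      using min[OF P[of y] False] mean_cost_opt(2)[OF l, of y W b "f y \<phi>'"]
      by (simp add: sample_cost_nonsingular[OF l False])
  qed (simp add: sample_cost_singular)
  then show "affine_vae n x f g W b l \<phi> \<le> affine_vae n x f g W b l \<phi>'"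
    unfolding opt unfolding affine_vae_eq_sum by (intro sum_mono)
qed

lemma affine_map_opt_mean: "affine_map (opt_mean W b l)"
proof -
  let ?G = "transpose W ** matrix_inv (mat l + W ** transpose W)"
  have "opt_mean W b l y = ?G *v y + - (?G *v b)" for y
    unfolding opt_mean_def matrix_vector_mul_assoc by (simp add: matrix_vector_mult_diff_distrib)
  then show ?thesis
    unfolding affine_map_def by (intro exI[of _ "(*v) ?G"] exI[of _ "- (?G *v b)"]) (auto simp: matrix_vector_mul_linear)
qed

lemma affine_map_const: "affine_map (\<lambda>_. c)"
  unfolding affine_map_def by (intro exI[of _ "\<lambda>_. 0"] exI[of _ c]) (simp add: linear_zero)

theorem lemma1:
  fixes n :: nat
    and x :: "nat \<Rightarrow> real^'d"
    and f :: "real^'d \<Rightarrow> 'p \<Rightarrow> real^'k"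
    and g :: "real^'d \<Rightarrow> 'p \<Rightarrow> real^'k^'k"
  shows
    "(includes_affine f g \<longrightarrow>
       (\<exists>C::real. \<forall>(W::real^'k^'d) (b::real^'d) l. l > 0 \<longrightarrow>
         (\<exists>\<phi>. (\<forall>y. f y \<phi> = opt_mean W b l y) \<and>
              (\<forall>y. encoder_cov g \<phi> y = opt_cov W l) \<and>
              is_arg_min (affine_vae n x f g W b l) (\<lambda>_. True) \<phi> \<and>
              2 * affine_vae n x f g W b l \<phi> = ereal (vae_cost n x W b l + C))))
     \<and>
     (includes_diagonal_affine f g \<longrightarrow>
       (\<exists>C::real. \<forall>(W::real^'k^'d) (b::real^'d) l. l > 0 \<longrightarrow>
         (\<exists>\<phi>. (\<forall>y. f y \<phi> = opt_mean W b l y) \<and>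
              (\<forall>y. encoder_cov g \<phi> y = opt_cov_sep W l) \<and>
              is_arg_min (affine_vae n x f g W b l)
                (\<lambda>\<phi>'. \<forall>y. diagonal (encoder_cov g \<phi>' y)) \<phi> \<and>
              2 * affine_vae n x f g W b l \<phi> = ereal (vae_cost_sep n x W b l + C))))"
proof (intro conjI impI exI[of _ "real n * (CARD('d) * ln (2 * pi))"] allI)
  fix W :: "real^'k^'d" and b :: "real^'d" and l :: real
  assume fg: "includes_affine f g" and l: "l > 0"
  let ?M = "mat 1 + (1 / l) *\<^sub>R (transpose W ** W)"
  obtain S where S: "S ** transpose S = opt_cov W l" "det S \<noteq> 0"
    "cov_cost W l S = CARD('k) + ln (det ?M)"
    "\<And>S'. det S' \<noteq> 0 \<Longrightarrow> cov_cost W l S \<le> cov_cost W l S'"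
    using cov_cost_min[OF l, of W] by blast
  obtain \<phi> where \<phi>: "\<And>y. f y \<phi> = opt_mean W b l y" "\<And>y. g y \<phi> = S"
    using fg affine_map_opt_mean affine_map_const unfolding includes_affine_def by metis
  have opt: "2 * affine_vae n x f g W b l \<phi>
      = ereal ((\<Sum>i<n. Omega (x i) W b (mat l)) + real n * (cov_cost W l S + CARD('d) * ln (2 * pi * l) - CARD('k)))"
    by (rule affine_vae_optimum(1)[where P="\<lambda>_. True", OF l S(2)]) (assumption | rule S(4) \<phi>)+
  have min: "affine_vae n x f g W b l \<phi> \<le> affine_vae n x f g W b l \<phi>'" if "\<And>y. True" for \<phi>'
    by (rule affine_vae_optimum(2)[where P="\<lambda>_. True", OF l S(2)]) (assumption | rule S(4) \<phi> that TrueI)+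
  \<comment> \<open>A whitening factor shows det \<open>?M\<close> > 0, which splitting the
    logarithm of the product requires.\<close>
  obtain A :: "real^'k^'k" where "transpose A ** ?M ** A = mat 1"
    using posdef_diagonalize[OF posdef_scalar_plus_gram[of 1 "1 / l" W]] l by auto
  then have "det ?M * (det A)\<^sup>2 = 1"
    by (rule diagonalize_inverse)
  then have "0 < det ?M"
    by (metis zero_less_mult_pos2 zero_less_one zero_less_power2 mult_zero_right zero_neq_one power_zero_numeral)
  then have "ln (det (mat l + W ** transpose W)) = CARD('d) * ln l + ln (det ?M)"
    unfolding det_scalar_plus_gram_swap[OF l] by (subst ln_mult_pos) (simp_all add: l ln_realpow)
  moreover have "ln (2 * pi * l) = ln (2 * pi) + ln l"
    using l by (intro ln_mult_pos) auto
  \<comment> \<open>The \<open>CARD('k)\<close> of the minimal covariance cost cancels that of the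
    divergence, and \<open>CARD('d) * ln l\<close> joins ln det \<open>?M\<close> to form the
    log-determinant of the marginal covariance. What remains per sample is
    \<open>CARD('d) * ln (2 * pi)\<close>, which fixes the constant.\<close>
  ultimately have "2 * affine_vae n x f g W b l \<phi> = ereal (vae_cost n x W b l + real n * (CARD('d) * ln (2 * pi)))"
    unfolding opt by (simp add: vae_cost_def S(3) algebra_simps)
  then show "\<exists>\<phi>. (\<forall>y. f y \<phi> = opt_mean W b l y) \<and> (\<forall>y. encoder_cov g \<phi> y = opt_cov W l) \<and>
      is_arg_min (affine_vae n x f g W b l) (\<lambda>_. True) \<phi> \<and>
      2 * affine_vae n x f g W b l \<phi> = ereal (vae_cost n x W b l + real n * (CARD('d) * ln (2 * pi)))"
    using min by (intro exI[of _ \<phi>]) (auto simp: \<phi> encoder_cov_def S(1) is_arg_min_def not_less)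
next
  fix W :: "real^'k^'d" and b :: "real^'d" and l :: real
  assume fg: "includes_diagonal_affine f g" and l: "l > 0"
  obtain S where S: "diagonal S" "S ** transpose S = opt_cov_sep W l" "det S \<noteq> 0"
    "cov_cost W l S = CARD('k) + (\<Sum>j\<in>UNIV. ln (l + (norm (column j W))\<^sup>2)) - CARD('k) * ln l"
    "\<And>S'. diagonal (S' ** transpose S') \<Longrightarrow> det S' \<noteq> 0 \<Longrightarrow> cov_cost W l S \<le> cov_cost W l S'"
    using cov_cost_min_diagonal[OF l, of W] by blast
  obtain \<phi> where \<phi>: "\<And>y. f y \<phi> = opt_mean W b l y" "\<And>y. g y \<phi> = S"
    using fg affine_map_opt_mean affine_map_const S(1) unfolding includes_diagonal_affine_def by metis
  have opt: "2 * affine_vae n x f g W b l \<phi>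
      = ereal ((\<Sum>i<n. Omega (x i) W b (mat l)) + real n * (cov_cost W l S + CARD('d) * ln (2 * pi * l) - CARD('k)))"
    by (rule affine_vae_optimum(1)[where P="\<lambda>S. diagonal (S ** transpose S)", OF l S(3)]) (assumption | rule S(5) \<phi>)+
  have min: "affine_vae n x f g W b l \<phi> \<le> affine_vae n x f g W b l \<phi>'" if "\<And>y. diagonal (g y \<phi>' ** transpose (g y \<phi>'))" for \<phi>'
    by (rule affine_vae_optimum(2)[where P="\<lambda>S. diagonal (S ** transpose S)", OF l S(3)]) (assumption | rule S(5) \<phi> that TrueI)+
  have "ln (2 * pi * l) = ln (2 * pi) + ln l"
    using l by (intro ln_mult_pos) auto
  \<comment> \<open>Here \<open>CARD('d) * ln l\<close> from the likelihood meets
    \<open>- CARD('k) * ln l\<close> from the covariance cost; the constant is as in the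
    unconstrained case.\<close>
  then have "2 * affine_vae n x f g W b l \<phi> = ereal (vae_cost_sep n x W b l + real n * (CARD('d) * ln (2 * pi)))"
    unfolding opt by (simp add: vae_cost_sep_def S(4) algebra_simps)
  moreover have "diagonal (opt_cov_sep W l)"
    by (simp add: opt_cov_sep_def diagonal_def)
  ultimately show "\<exists>\<phi>. (\<forall>y. f y \<phi> = opt_mean W b l y) \<and> (\<forall>y. encoder_cov g \<phi> y = opt_cov_sep W l) \<and>
      is_arg_min (affine_vae n x f g W b l) (\<lambda>\<phi>'. \<forall>y. diagonal (encoder_cov g \<phi>' y)) \<phi> \<and>
      2 * affine_vae n x f g W b l \<phi> = ereal (vae_cost_sep n x W b l + real n * (CARD('d) * ln (2 * pi)))"
    using min by (intro exI[of _ \<phi>]) (auto simp: \<phi> encoder_cov_def S(2) is_arg_min_def not_less)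
qed

end
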